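(* Let $l\geq 1$ be an integer and $n=2l$. Let $B$ be the standard Borel subgroup of $\mathrm{SP}_n=\mathrm{SP}_n(\mathbf{C})$, acting by conjugation on the variety $\mathcal{N}(2)=\{x\in\mathfrak{sp}_n \mid x^2=0\}$. Then the $B$-orbits in $\mathcal{N}(2)$ are in bijection with the set $\mathrm{Solp}_l$ of symplectic oriented link patterns of size $l$.
   Context: The ground field is $K=\mathbf{C}$. Let $J_l$ be the $l\times l$ anti-diagonal matrix with all anti-diagonal entries equal to $1$, and $F=\begin{pmatrix}0&J_l\\-J_l&0\end{pmatrix}$. Then $\mathrm{SP}_{2l}=\{A\in \mathrm{GL}_{2l}(K)\mid A^TFA=F\}$ with Lie algebra $\mathfrak{sp}_{2l}=\{a\in K^{2l\times 2l}\mid a^TF+Fa=0\}$. The standard Borel subgroup $B$ is the group of upper-triangular matrices in $\mathrm{SP}_{2l}$. A symplectic oriented link pattern (solp) of size $l$ consists of $l$ vertices $1,2,\dots,l$ together with a collection of oriented arrows between these vertices and a collection of oriented arrows with dots between these vertices, such that: (B) every vertex is touched by at most one arrow (dotted or not); (SpOr) there are no loops without dots (no undotted arrow from a vertex to itself). Loops with dots are allowed, and a dotted loop at a vertex comes in two different orientations (clockwise and counterclockwise), which are regarded as different. A loop counts as one arrow touching its vertex. $\mathrm{Solp}_l$ denotes the set of solps of size $l$. *)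

theory Defs
  imports "Jordan_Normal_Form.Matrix" "HOL-Algebra.Group_Action"
begin

definition antidiag_mat :: "nat \<Rightarrow> complex mat" where
  "antidiag_mat l = mat l l (\<lambda>(i, j). if i + j + 1 = l then 1 else 0)"

definition symplectic_form :: "nat \<Rightarrow> complex mat" where
  "symplectic_form l =
     four_block_mat (0\<^sub>m l l) (antidiag_mat l) (- antidiag_mat l) (0\<^sub>m l l)"

definition GL :: "nat \<Rightarrow> complex mat monoid" where
  "GL n = units_of (ring_mat TYPE(complex) n ())"

text \<open>In \<open>SP\<close>, \<open>borel_SP\<close>, \<open>lie_sp\<close> and \<open>nilpotent2\<close>, the argument \<open>l\<close> is half the matrix size.\<close>

definition SP :: "nat \<Rightarrow> complex mat monoid" where
  "SP l = (GL (2 * l))\<lparr>carrier :=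
     {A \<in> carrier (GL (2 * l)). A\<^sup>T * symplectic_form l * A = symplectic_form l}\<rparr>"

definition borel_SP :: "nat \<Rightarrow> complex mat monoid" where
  "borel_SP l = (SP l)\<lparr>carrier := {A \<in> carrier (SP l). upper_triangular A}\<rparr>"

definition lie_sp :: "nat \<Rightarrow> complex mat set" where
  "lie_sp l = {a \<in> carrier_mat (2 * l) (2 * l).
     a\<^sup>T * symplectic_form l + symplectic_form l * a = 0\<^sub>m (2 * l) (2 * l)}"

definition nilpotent2 :: "nat \<Rightarrow> complex mat set" where
  "nilpotent2 l = {x \<in> lie_sp l. x ^\<^sub>m 2 = 0\<^sub>m (2 * l) (2 * l)}"

definition conjugation :: "nat \<Rightarrow> complex mat \<Rightarrow> complex mat \<Rightarrow> complex mat" where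
  "conjugation n g x = g * x * inv\<^bsub>GL n\<^esub> g"

datatype loop_orientation = Clockwise | Counterclockwise

text \<open>
  The Boolean component says whether the arrow carries a dot.  \<open>Arrow d i j\<close> is an arrow from
  \<open>i\<close> to \<open>j\<close> with \<open>i \<noteq> j\<close>.  Loops have their own constructor because a loop is not
  determined by source and target: it also has one of two orientations.
\<close>

datatype arrow =
    Arrow bool nat nat
  | Loop bool nat loop_orientation

fun touched :: "arrow \<Rightarrow> nat set" where
  "touched (Arrow d i j) = {i, j}"
| "touched (Loop d i r) = {i}"

definition arrows_on :: "nat \<Rightarrow> arrow set" where
  "arrows_on l = {a. touched a \<subseteq> {1..l} \<and> (\<forall>d i j. a = Arrow d i j \<longrightarrow> i \<noteq> j)}"

text \<open>
  A pattern is a set of arrows: multiplicities cannot occur, since two parallel copies of an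
  arrow would both touch the same vertex.
\<close>

definition Solp :: "nat \<Rightarrow> arrow set set" where
  "Solp l = {S. S \<subseteq> arrows_on l
     \<and> (\<forall>v \<in> {1..l}. \<forall>a \<in> S. \<forall>b \<in> S. v \<in> touched a \<and> v \<in> touched b \<longrightarrow> a = b)
     \<and> (\<forall>i r. Loop False i r \<notin> S)}"

end

theory Submission
  imports Defs "Jordan_Normal_Form.Determinant"
begin

text \<open>
  The map \<open>x \<mapsto> x F\<close> turns \<open>\<N>(2)\<close> into the set of symmetric matrices \<open>S\<close> with \<open>S F S = 0\<close>, and
  conjugation by \<open>b\<close> into the congruence \<open>S \<mapsto> b S b\<^sup>T\<close>.  Rows of \<open>b\<close> form a symplectic basis adapted
  to the standard flag, so an orbit is described by the shapes \<open>S\<close> takes in such bases.  Starting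
  with the last nonzero row \<open>i\<close> and its last nonzero column \<open>j\<close>, one splits off the span of
  \<open>e\<^sub>i, e\<^sub>j\<close> together with the vectors dual to them under \<open>F\<close>; by \<open>S F S = 0\<close> the latter lie in
  the radical of \<open>S\<close>, and the choice of the pivot keeps the new basis triangular.  Iterating, every
  orbit contains a symmetric partial permutation matrix whose support never meets both \<open>p\<close> and \<open>2l + 1 - p\<close>.
  Such matrices are the patterns: vertex \<open>i\<close> stands for the pair \<open>i, 2l + 1 - i\<close>, and the four ways of
  choosing one index from each of two pairs are the four arrows between two vertices, while the
  two diagonal positions over a vertex are its two dotted loops.  The matrix is unique in its orbit
  because \<open>b S = S' b'\<close> with \<open>b\<close> upper and \<open>b'\<close> lower triangular forces \<open>S = S'\<close> for partial permutation
  matrices.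
\<close>

section \<open>Bilinear forms and the symplectic form\<close>

text \<open>Matrix indices start at \<open>0\<close>, so \<open>opp l k\<close> is the index \<open>2l + 1 - k\<close> of one-based notation.\<close>

definition opp :: "nat \<Rightarrow> nat \<Rightarrow> nat" where
  "opp l k = 2 * l - 1 - k"

text \<open>The nonzero entry of row \<open>k\<close> of \<open>F\<close>, which stands in column
  \<open>opp l k\<close>.\<close>

definition sg :: "nat \<Rightarrow> nat \<Rightarrow> complex" where
  "sg l k = (if k < l then 1 else - 1)"

lemma opp_less [simp]: "k < 2 * l \<Longrightarrow> opp l k < 2 * l"
  by (simp add: opp_def)

lemma opp_opp [simp]: "k < 2 * l \<Longrightarrow> opp l (opp l k) = k"
  by (simp add: opp_def)

lemma opp_neq [simp]: "k < 2 * l \<Longrightarrow> opp l k \<noteq> k"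
  by (simp add: opp_def) presburger

lemma opp_eq_iff: "p < 2 * l \<Longrightarrow> q < 2 * l \<Longrightarrow> opp l p = q \<longleftrightarrow> p = opp l q"
  by (auto simp: opp_def)

lemma sg_opp: "k < 2 * l \<Longrightarrow> sg l (opp l k) = - sg l k"
  by (auto simp: sg_def opp_def)

lemma sg_square [simp]: "sg l k * sg l k = 1"
  by (simp add: sg_def)

lemma sg_neq_0 [simp]: "sg l k \<noteq> 0"
  by (simp add: sg_def)

lemma symplectic_form_carrier [simp]: "symplectic_form l \<in> carrier_mat (2 * l) (2 * l)"
  by (auto simp: symplectic_form_def antidiag_mat_def mult_2 intro!: four_block_carrier_mat)

lemma symplectic_form_index:
  assumes "i < 2 * l" "j < 2 * l"
  shows "symplectic_form l $$ (i, j) = (if j = opp l i then sg l i else 0)"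
  using assms by (auto simp: symplectic_form_def antidiag_mat_def opp_def sg_def)

lemma mult_mat_index:
  assumes "A \<in> carrier_mat n m" "B \<in> carrier_mat m k" "i < n" "j < k"
  shows "(A * B) $$ (i, j) = (\<Sum>r<m. A $$ (i, r) * B $$ (r, j))"
  using assms by (auto simp: scalar_prod_def atLeast0LessThan intro!: sum.cong)

lemma mult_symplectic_index:
  assumes "A \<in> carrier_mat m (2 * l)" "i < m" "j < 2 * l"
  shows "(A * symplectic_form l) $$ (i, j) = - sg l j * A $$ (i, opp l j)"
proof -
  have "(A * symplectic_form l) $$ (i, j)
      = (\<Sum>r<2 * l. A $$ (i, r) * (if j = opp l r then sg l r else 0))"
    using assms by (simp add: mult_mat_index[OF assms(1) symplectic_form_carrier]
        symplectic_form_index)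
  also have "\<dots> = (\<Sum>r<2 * l. if r = opp l j then A $$ (i, r) * sg l r else 0)"
    using assms by (intro sum.cong) (auto simp: opp_eq_iff)
  finally show ?thesis
    using assms by (simp add: sg_opp)
qed

lemma symplectic_form_square:
  "symplectic_form l * symplectic_form l = - 1\<^sub>m (2 * l)"
proof (rule eq_matI)
  fix i j
  assume ij: "i < dim_row (- 1\<^sub>m (2 * l) :: complex mat)"
    "j < dim_col (- 1\<^sub>m (2 * l) :: complex mat)"
  then show "(symplectic_form l * symplectic_form l) $$ (i, j) = (- 1\<^sub>m (2 * l)) $$ (i, j)"
    by (auto simp: mult_symplectic_index[OF symplectic_form_carrier] symplectic_form_index
        opp_eq_iff sg_opp simp del: index_mult_mat(1))
qed (use carrier_matD[OF symplectic_form_carrier[of l]] in auto)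

section \<open>Values of bilinear forms on coefficient vectors\<close>

definition bil :: "complex mat \<Rightarrow> (nat \<Rightarrow> complex) \<Rightarrow> (nat \<Rightarrow> complex) \<Rightarrow> complex" where
  "bil M u v = (\<Sum>r<dim_row M. \<Sum>s<dim_col M. u r * M $$ (r, s) * v s)"

definition delta :: "nat \<Rightarrow> nat \<Rightarrow> complex" where
  "delta p = (\<lambda>r. if r = p then 1 else 0)"

lemma bil_scale_left: "bil M (\<lambda>r. c * u r) v = c * bil M u v"
  by (simp add: bil_def sum_distrib_left mult_ac)

lemma bil_scale_right: "bil M u (\<lambda>r. c * v r) = c * bil M u v"
  by (simp add: bil_def sum_distrib_left mult_ac)

lemma bil_diff_left: "bil M (\<lambda>r. u r - u' r) v = bil M u v - bil M u' v"
  by (simp add: bil_def sum_subtractf left_diff_distrib)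

lemma bil_diff_right: "bil M u (\<lambda>r. v r - v' r) = bil M u v - bil M u v'"
  by (simp add: bil_def sum_subtractf right_diff_distrib)

lemma bil_minus_left: "bil M (\<lambda>r. - u r) v = - bil M u v"
  by (simp add: bil_def sum_negf)

lemma bil_divide_left: "bil M (\<lambda>r. u r / c) v = bil M u v / c"
  using bil_scale_left[of M "1 / c"] by simp

lemma bil_divide_right: "bil M u (\<lambda>r. v r / c) = bil M u v / c"
  using bil_scale_right[of M u "1 / c"] by simp

lemma bil_sum_left: "bil M (\<lambda>r. \<Sum>p\<in>P. w p r) v = (\<Sum>p\<in>P. bil M (w p) v)"
proof -
  have "bil M (\<lambda>r. \<Sum>p\<in>P. w p r) v
      = (\<Sum>r<dim_row M. \<Sum>p\<in>P. \<Sum>s<dim_col M. w p r * M $$ (r, s) * v s)"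
    unfolding bil_def sum_distrib_right by (intro sum.cong refl sum.swap)
  also have "\<dots> = (\<Sum>p\<in>P. bil M (w p) v)"
    unfolding bil_def by (rule sum.swap)
  finally show ?thesis .
qed

lemma bil_sum_right: "bil M u (\<lambda>r. \<Sum>p\<in>P. w p r) = (\<Sum>p\<in>P. bil M u (w p))"
proof -
  have "bil M u (\<lambda>r. \<Sum>p\<in>P. w p r)
      = (\<Sum>r<dim_row M. \<Sum>p\<in>P. \<Sum>s<dim_col M. u r * M $$ (r, s) * w p s)"
    unfolding bil_def sum_distrib_left by (intro sum.cong refl sum.swap)
  also have "\<dots> = (\<Sum>p\<in>P. bil M u (w p))"
    unfolding bil_def by (rule sum.swap)
  finally show ?thesis .
qed

lemmas bil_linear = bil_diff_left bil_diff_right bil_scale_left bil_scale_right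
  bil_sum_left bil_sum_right bil_minus_left
  bil_divide_left bil_divide_right

lemma bil_delta_left:
  assumes "p < dim_row M"
  shows "bil M (delta p) v = (\<Sum>s<dim_col M. M $$ (p, s) * v s)"
proof -
  have "bil M (delta p) v
      = (\<Sum>r<dim_row M. if r = p then \<Sum>s<dim_col M. M $$ (r, s) * v s else 0)"
    unfolding bil_def delta_def by (intro sum.cong) auto
  then show ?thesis using assms by simp
qed

lemma bil_delta_delta:
  assumes "p < dim_row M" "q < dim_col M"
  shows "bil M (delta p) (delta q) = M $$ (p, q)"
proof -
  have "(\<Sum>s<dim_col M. M $$ (p, s) * delta q s)
      = (\<Sum>s<dim_col M. if s = q then M $$ (p, s) else 0)"
    unfolding delta_def by (intro sum.cong) auto
  then show ?thesis using assms by (simp add: bil_delta_left)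
qed

lemma bil_expand_left:
  "bil M u v = (\<Sum>r<dim_row M. u r * bil M (delta r) v)"
  unfolding bil_def[of M u v]
  by (intro sum.cong refl) (simp add: bil_delta_left sum_distrib_left mult.assoc)

text \<open>The factor \<open>c\<close> lets one proof serve the symmetric matrices
  (\<open>c = 1\<close>) and the antisymmetric \<open>F\<close> (\<open>c = -1\<close>).\<close>

lemma bil_sym:
  assumes "M \<in> carrier_mat n n" "\<And>p q. p < n \<Longrightarrow> q < n \<Longrightarrow> M $$ (p, q) = c * M $$ (q, p)"
  shows "bil M u v = c * bil M v u"
proof -
  have "bil M u v = (\<Sum>r<n. \<Sum>s<n. u r * (c * M $$ (s, r)) * v s)"
    unfolding bil_def using assms(1) by (intro sum.cong) (auto simp: assms(2)[symmetric])
  also have "\<dots> = (\<Sum>s<n. \<Sum>r<n. u r * (c * M $$ (s, r)) * v s)"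
    by (rule sum.swap)
  also have "\<dots> = c * bil M v u"
    using assms(1) by (simp add: bil_def sum_distrib_left mult_ac)
  finally show ?thesis .
qed

text \<open>The dictionary for everything below: the rows of \<open>B\<close> are new basis vectors,
  and the congruent matrix is the Gram matrix of the form on them.\<close>

lemma congruence_index:
  assumes "M \<in> carrier_mat n n" "B \<in> carrier_mat n n" "p < n" "q < n"
  shows "(B * M * B\<^sup>T) $$ (p, q) = bil M (\<lambda>r. B $$ (p, r)) (\<lambda>r. B $$ (q, r))"
proof -
  have "(B * M * B\<^sup>T) $$ (p, q) = (\<Sum>s<n. \<Sum>r<n. B $$ (p, r) * M $$ (r, s) * B $$ (q, s))"
    using assms by (subst mult_mat_index[of _ n n _ n])
      (auto simp: mult_mat_index[OF assms(2,1)] sum_distrib_right simp del: index_mult_mat(1)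
        intro!: sum.cong)
  also have "\<dots> = (\<Sum>r<n. \<Sum>s<n. B $$ (p, r) * M $$ (r, s) * B $$ (q, s))"
    by (rule sum.swap)
  finally show ?thesis using assms by (simp add: bil_def)
qed

lemma bil_symplectic_delta:
  assumes "k < 2 * l"
  shows "bil (symplectic_form l) (delta k) v = sg l k * v (opp l k)"
proof -
  have "bil (symplectic_form l) (delta k) v
      = (\<Sum>s<2 * l. symplectic_form l $$ (k, s) * v s)"
    using assms carrier_matD[OF symplectic_form_carrier[of l]] by (simp add: bil_delta_left)
  also have "\<dots> = (\<Sum>s<2 * l. if s = opp l k then sg l k * v s else 0)"
    using assms by (intro sum.cong) (auto simp: symplectic_form_index)
  finally show ?thesis using assms by simp
qed

lemma bil_symplectic:
  "bil (symplectic_form l) u v = (\<Sum>r<2 * l. u r * sg l r * v (opp l r))"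
  unfolding bil_expand_left[of _ u] using carrier_matD[OF symplectic_form_carrier[of l]]
  by (intro sum.cong) (simp_all add: bil_symplectic_delta mult.assoc)

lemma bil_symplectic_antisym:
  "bil (symplectic_form l) u v = - bil (symplectic_form l) v u"
  using bil_sym[OF symplectic_form_carrier, of l "-1" u v]
  by (auto simp: symplectic_form_index opp_eq_iff sg_opp)

section \<open>Symmetric forms with S F S = 0 and the group acting on them by congruence\<close>

definition sym_forms :: "nat \<Rightarrow> complex mat set" where
  "sym_forms l = {S \<in> carrier_mat (2 * l) (2 * l).
     S\<^sup>T = S \<and> S * symplectic_form l * S = 0\<^sub>m (2 * l) (2 * l)}"

text \<open>The transpose is on the right so that membership speaks about the rows of
  \<open>b\<close>: their Gram matrix under \<open>F\<close> is \<open>F\<close>. By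
  \<open>symplectic_transpose_iff\<close> this is the usual symplectic condition.\<close>

definition borel :: "nat \<Rightarrow> complex mat set" where
  "borel l = {b \<in> carrier_mat (2 * l) (2 * l).
     upper_triangular b \<and> b * symplectic_form l * b\<^sup>T = symplectic_form l}"

lemma sym_formsD:
  assumes "S \<in> sym_forms l"
  shows "S \<in> carrier_mat (2 * l) (2 * l)"
    and "\<And>p q. p < 2 * l \<Longrightarrow> q < 2 * l \<Longrightarrow> S $$ (p, q) = S $$ (q, p)"
    and "\<And>u. bil (symplectic_form l) (\<lambda>r. bil S (delta r) u) (\<lambda>r. bil S (delta r) v) = 0"
proof -
  let ?n = "2 * l"
  show S: "S \<in> carrier_mat ?n ?n"
    using assms by (simp add: sym_forms_def)
  have T: "S\<^sup>T = S"
    using assms by (simp add: sym_forms_def)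
  show sym: "S $$ (p, q) = S $$ (q, p)" if "p < ?n" "q < ?n" for p q
    using that S arg_cong[OF T, of "\<lambda>M. M $$ (p, q)"] by simp
  \<comment> \<open>As \<open>S\<close> is symmetric, \<open>S F S = 0\<close> says that its rows
    are pairwise orthogonal under \<open>F\<close>; bilinearity extends this to their linear
    combinations.\<close>
  have zero: "bil (symplectic_form l) (\<lambda>r. S $$ (p, r)) (\<lambda>r. S $$ (q, r)) = 0"
    if "p < ?n" "q < ?n" for p q
    using assms congruence_index[OF symplectic_form_carrier S that] that
    by (simp add: sym_forms_def)
  fix u
  have exp: "bil S (delta r) w = (\<Sum>q<?n. w q * S $$ (q, r))" if "r < ?n" for r w
    using that S by (auto simp: bil_delta_left sym mult.commute intro!: sum.cong)
  have cong: "bil (symplectic_form l) f g = bil (symplectic_form l) f' g'"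
    if "\<And>r. r < ?n \<Longrightarrow> f r = f' r" "\<And>r. r < ?n \<Longrightarrow> g r = g' r" for f g f' g'
    using that unfolding bil_symplectic by (intro sum.cong) auto
  have "bil (symplectic_form l) (\<lambda>r. bil S (delta r) u) (\<lambda>r. bil S (delta r) v)
      = bil (symplectic_form l) (\<lambda>r. \<Sum>q<?n. u q * S $$ (q, r)) (\<lambda>r. \<Sum>q<?n. v q * S $$ (q, r))"
    by (rule cong) (simp_all add: exp)
  also have "\<dots> = 0"
    by (simp add: bil_linear zero)
  finally show "bil (symplectic_form l) (\<lambda>r. bil S (delta r) u) (\<lambda>r. bil S (delta r) v) = 0" .
qed

text \<open>In matrix terms this is \<open>F S u\<close>, the vector that represents the functional
  \<open>S(u, -)\<close> through \<open>F\<close>.\<close>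

definition sharp :: "nat \<Rightarrow> complex mat \<Rightarrow> (nat \<Rightarrow> complex) \<Rightarrow> nat \<Rightarrow> complex" where
  "sharp l S u = (\<lambda>r. sg l r * bil S (delta (opp l r)) u)"

lemma bil_sharp:
  assumes "S \<in> sym_forms l"
  shows "bil (symplectic_form l) (sharp l S u) v = bil S u v"
proof -
  have "bil (symplectic_form l) (sharp l S u) v
      = (\<Sum>r<2 * l. bil S (delta (opp l r)) u * v (opp l r))"
    unfolding bil_symplectic sharp_def by (intro sum.cong) (auto simp: sg_def)
  also have "\<dots> = (\<Sum>r<2 * l. v r * bil S (delta r) u)"
    by (rule sum.reindex_bij_witness[of _ "opp l" "opp l"]) auto
  also have "\<dots> = bil S v u"
    using sym_formsD(1)[OF assms] by (simp add: bil_expand_left[of S v])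
  also have "\<dots> = bil S u v"
    using bil_sym[OF sym_formsD(1)[OF assms], of 1 v u] sym_formsD(2)[OF assms] by auto
  finally show ?thesis .
qed

text \<open>Up to sign the value is that of \<open>S F S\<close> at \<open>u\<close> and
  \<open>v\<close>. The reindexing by \<open>opp\<close> moves the sign of \<open>F\<close> from one
  factor to the other.\<close>

lemma bil_sharp_radical:
  assumes "S \<in> sym_forms l"
  shows "bil S (sharp l S u) v = 0"
proof -
  have "bil S (sharp l S u) v = (\<Sum>r<2 * l. sharp l S u r * bil S (delta r) v)"
    using sym_formsD(1)[OF assms] by (simp add: bil_expand_left[of S "sharp l S u"])
  also have "\<dots> = (\<Sum>r<2 * l. sg l r * bil S (delta (opp l r)) u * bil S (delta r) v)"
    by (simp add: sharp_def)
  also have "\<dots> = (\<Sum>r<2 * l. - (bil S (delta r) u * sg l r * bil S (delta (opp l r)) v))"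
    by (rule sum.reindex_bij_witness[of _ "opp l" "opp l"]) (auto simp: sg_opp)
  also have "\<dots> = 0"
    using sym_formsD(3)[OF assms, of u v] by (simp add: bil_symplectic sum_negf)
  finally show ?thesis .
qed

lemma bil_sym_forms_commute:
  assumes "S \<in> sym_forms l"
  shows "bil S u v = bil S v u"
  using bil_sym[OF sym_formsD(1)[OF assms], of 1 u v] sym_formsD(2)[OF assms] by auto

section \<open>Adapted symplectic bases\<close>

lemma bil_cong:
  assumes "\<And>r. r < dim_row M \<Longrightarrow> u r = u' r" "\<And>r. r < dim_col M \<Longrightarrow> v r = v' r"
  shows "bil M u v = bil M u' v'"
  unfolding bil_def using assms by (intro sum.cong) auto

text \<open>The new basis keeps \<open>u p\<close> at each pivot \<open>p\<close>, puts an
  \<open>F\<close>-dual vector at \<open>opp l p\<close>, and projects the other standard vectors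
  off the span of the \<open>u p\<close> with respect to \<open>S\<close>. That span is isotropic
  for \<open>F\<close> because \<open>P\<close> never contains both \<open>p\<close> and
  \<open>opp l p\<close>. The hypotheses \<open>tri\<close> and \<open>dom\<close> make the basis
  triangular. The last conclusion protects entries in rows that are already orthogonal to the
  pivots.\<close>

lemma pivot_basis:
  assumes S: "S \<in> sym_forms l"
    and P: "P \<subseteq> {..<2 * l}" "\<And>p. p \<in> P \<Longrightarrow> opp l p \<notin> P"
    and \<sigma>: "\<And>p. p \<in> P \<Longrightarrow> \<sigma> p \<in> P" "\<And>p. p \<in> P \<Longrightarrow> \<sigma> (\<sigma> p) = p"
    and gram: "\<And>p q. p \<in> P \<Longrightarrow> q \<in> P \<Longrightarrow> bil S (u p) (u q) = (if q = \<sigma> p then 1 else 0)"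
    and supp: "\<And>p r. p \<in> P \<Longrightarrow> r \<notin> P \<Longrightarrow> u p r = 0"
    and tri: "\<And>p r. p \<in> P \<Longrightarrow> r < p \<Longrightarrow> u p r = 0"
    and dom: "\<And>p k. p \<in> P \<Longrightarrow> p < k \<Longrightarrow> k < 2 * l \<Longrightarrow> bil S (delta k) (u (\<sigma> p)) = 0"
  obtains b where "b \<in> borel l"
    and "\<And>p k. p \<in> P \<Longrightarrow> k < 2 * l \<Longrightarrow> (b * S * b\<^sup>T) $$ (p, k) = (if k = \<sigma> p then 1 else 0)"
    and "\<And>p k. p \<in> P \<Longrightarrow> k < 2 * l \<Longrightarrow> (b * S * b\<^sup>T) $$ (opp l p, k) = 0"
    and "\<And>k m. k < 2 * l \<Longrightarrow> m < 2 * l \<Longrightarrow> k \<notin> P \<Longrightarrow> opp l k \<notin> P \<Longrightarrow> m \<notin> P \<Longrightarrow> opp l m \<notin> P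
      \<Longrightarrow> (\<And>p. p \<in> P \<Longrightarrow> bil S (delta k) (u p) = 0) \<Longrightarrow> (b * S * b\<^sup>T) $$ (k, m) = S $$ (k, m)"
proof -
  let ?n = "2 * l" and ?F = "symplectic_form l"
  let ?R = "\<lambda>k. k < ?n \<and> k \<notin> P \<and> opp l k \<notin> P"
  \<comment> \<open>The dual row for \<open>p\<close> uses \<open>u (\<sigma> p)\<close> because
    \<open>F(sharp (u (\<sigma> p)), u q) = S(u (\<sigma> p), u q)\<close> is 1 exactly for
    \<open>q = p\<close>. In the third case the sum is the \<open>S\<close>-projection onto the
    span, since the Gram matrix there is the permutation \<sigma>.\<close>
  define w where "w k = (if k \<in> P then u k
      else if opp l k \<in> P then (\<lambda>r. sg l k * sharp l S (u (\<sigma> (opp l k))) r)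
      else (\<lambda>r. delta k r - (\<Sum>p\<in>P. bil S (delta k) (u (\<sigma> p)) * u p r)))" for k
  define b where "b = mat ?n ?n (\<lambda>(k, r). w k r)"
  note Sc = sym_formsD(1)[OF S] and comm = bil_sym_forms_commute[OF S]
  have Pn: "p < ?n" if "p \<in> P" for p
    using P(1) that by auto
  have fin: "finite P"
    using P(1) finite_subset by blast
  have wP: "w k = u k" if "k \<in> P" for k
    using that by (simp add: w_def)
  have wQ: "w (opp l k) = (\<lambda>r. - sg l k * sharp l S (u (\<sigma> k)) r)" if "k \<in> P" for k
    using that P(2)[OF that] Pn[OF that] by (simp add: w_def sg_opp)
  have wR: "w k = (\<lambda>r. delta k r - (\<Sum>p\<in>P. bil S (delta k) (u (\<sigma> p)) * u p r))" if "?R k" for k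
    using that by (simp add: w_def)
  have kinds: "k \<in> P \<or> (\<exists>p\<in>P. k = opp l p) \<or> ?R k" if "k < ?n" for k
    using that by (metis opp_opp)
  have flip: "bil ?F x y = - bil ?F y x" for x y
    by (rule bil_symplectic_antisym)
  have uu: "bil ?F (u p) (u q) = 0" if "p \<in> P" "q \<in> P" for p q
    unfolding bil_symplectic
  proof (rule sum.neutral, rule ballI)
    fix r
    show "u p r * sg l r * u q (opp l r) = 0"
      using supp that P(2) by (cases "r \<in> P") auto
  qed
  have du: "bil ?F (delta k) (u q) = 0" if "?R k" "q \<in> P" for k q
    using that supp by (simp add: bil_symplectic_delta)
  have Ru: "bil ?F (w k) (u q) = 0" if "?R k" "q \<in> P" for k q
    using that by (simp add: wR bil_linear du uu cong: sum.cong)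
  have RuS: "bil S (w k) (u q) = 0" if "?R k" "q \<in> P" for k q
  proof -
    have "(\<Sum>p\<in>P. bil S (delta k) (u (\<sigma> p)) * bil S (u p) (u q))
        = (\<Sum>p\<in>P. if p = \<sigma> q then bil S (delta k) (u q) else 0)"
      using that \<sigma> by (intro sum.cong) (auto simp: gram)
    also have "\<dots> = bil S (delta k) (u q)"
      using fin that \<sigma>(1) by simp
    finally show ?thesis using that by (simp add: wR bil_linear)
  qed
  \<comment> \<open>Only these types of pairs are computed; antisymmetry yields the remaining ones
    in \<open>om\<close>.\<close>
  have half: "bil ?F (w k) (w m) = ?F $$ (k, m)"
    if km: "k < ?n" "m < ?n"
      and cases: "k \<in> P \<and> m \<in> P \<or> (\<exists>p\<in>P. k = opp l p) \<or> ?R k \<and> m \<in> P \<or> ?R k \<and> ?R m" for k m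
  proof -
    consider (PP) "k \<in> P" "m \<in> P" | (Q) p where "p \<in> P" "k = opp l p"
      | (RP) "?R k" "m \<in> P" | (RR) "?R k" "?R m"
      using cases by blast
    then show ?thesis
    proof cases
      case PP
      moreover have "m \<noteq> opp l k"
        using \<open>k \<in> P\<close> \<open>m \<in> P\<close> P(2) by auto
      ultimately show ?thesis
        using km by (simp add: wP uu symplectic_form_index)
    next
      case RP
      moreover have "m \<noteq> opp l k"
        using \<open>?R k\<close> \<open>m \<in> P\<close> by auto
      ultimately show ?thesis
        using km by (simp add: wP Ru symplectic_form_index)
    next
      case RR
      have 0: "bil ?F (u p) (delta m) = 0" if "p \<in> P" for p
        using du[OF \<open>?R m\<close> that] flip[of "u p" "delta m"] by simp
      have "bil ?F (w k) (w m) = bil ?F (w k) (delta m)"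
        unfolding wR[OF \<open>?R m\<close>] using Ru[OF \<open>?R k\<close>] by (simp add: bil_linear)
      also have "\<dots> = bil ?F (delta k) (delta m)"
        unfolding wR[OF \<open>?R k\<close>] using 0 by (simp add: bil_linear)
      also have "\<dots> = ?F $$ (k, m)"
        using km carrier_matD[OF symplectic_form_carrier[of l]] by (simp add: bil_delta_delta)
      finally show ?thesis .
    next
      case (Q p)
      note p = Q(1) and k = Q(2)
      have F: "?F $$ (k, m) = (if m = p then - sg l p else 0)"
        using km Pn[OF p] by (auto simp: k symplectic_form_index sg_opp)
      \<comment> \<open>Pairing with a dual row evaluates \<open>S\<close> at
        \<open>u (\<sigma> p)\<close>, so the three kinds of \<open>m\<close> are settled by the
        Gram matrix, the radical and the projection respectively.\<close>
      have eq: "bil ?F (w k) (w m) = - sg l p * bil S (u (\<sigma> p)) (w m)"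
        by (simp add: k wQ[OF p] bil_linear bil_sharp[OF S])
      consider "m \<in> P" | q where "q \<in> P" "m = opp l q" | "?R m"
        using kinds[OF km(2)] by blast
      then show ?thesis
      proof cases
        case 1
        then show ?thesis
          unfolding eq F using p \<sigma> by (auto simp: wP gram)
      next
        case (2 q)
        then have "m \<noteq> p"
          using p P(2) by auto
        moreover have "bil S (u (\<sigma> p)) (w m) = 0"
          using comm[of "u (\<sigma> p)"] bil_sharp_radical[OF S]
          by (simp add: 2 wQ[OF 2(1)] bil_linear)
        ultimately show ?thesis
          unfolding eq F by simp
      next
        case 3
        moreover have "m \<noteq> p"
          using 3 p by auto
        moreover have "bil S (u (\<sigma> p)) (w m) = 0"
          using RuS[OF 3 \<sigma>(1)[OF p]] comm[of "u (\<sigma> p)"] by simp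
        ultimately show ?thesis
          unfolding eq F by simp
      qed
    qed
  qed
  have om: "bil ?F (w k) (w m) = ?F $$ (k, m)" if "k < ?n" "m < ?n" for k m
  proof -
    have "?F $$ (k, m) = - ?F $$ (m, k)"
      using that by (auto simp: symplectic_form_index opp_eq_iff sg_opp)
    then show ?thesis
      using half[OF that] half[OF that(2,1)] flip[of "w k" "w m"] kinds[OF that(1)] kinds[OF that(2)]
      by metis
  qed
  have b: "b \<in> carrier_mat ?n ?n"
    by (simp add: b_def)
  have idx: "(b * M * b\<^sup>T) $$ (k, m) = bil M (w k) (w m)"
    if "M \<in> carrier_mat ?n ?n" "k < ?n" "m < ?n" for M k m
    unfolding congruence_index[OF that(1) b that(2,3)]
    using that by (intro bil_cong) (auto simp: b_def)
  \<comment> \<open>For dual rows, \<open>opp\<close> reverses the order and \<open>dom\<close>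
    applies. In a correction term, either \<open>p < k\<close> and \<open>dom\<close> kills the
    coefficient, or \<open>r < p\<close> and \<open>tri\<close> kills the entry.\<close>
  have wtri: "w k r = 0" if "r < k" "k < ?n" for k r
  proof -
    consider "k \<in> P" | p where "p \<in> P" "k = opp l p" | "?R k"
      using kinds[OF \<open>k < ?n\<close>] by blast
    then show ?thesis
    proof cases
      case 1
      then show ?thesis using tri that by (simp add: wP)
    next
      case (2 p)
      then have "p < opp l r"
        using that Pn[OF 2(1)] by (auto simp: opp_def)
      moreover have "opp l r < ?n"
        using that by (intro opp_less) simp
      ultimately show ?thesis
        using 2 dom by (simp add: wQ[OF 2(1)] sharp_def)
    next
      case 3
      have "bil S (delta k) (u (\<sigma> p)) * u p r = 0" if "p \<in> P" for p
        using dom[OF that, of k] tri[OF that, of r] \<open>r < k\<close> \<open>k < ?n\<close> by (cases "p < k") auto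
      moreover have "delta k r = 0"
        using \<open>r < k\<close> by (simp add: delta_def)
      ultimately show ?thesis
        unfolding wR[OF 3] by (subst sum.neutral, blast, simp)
    qed
  qed
  have "b \<in> borel l"
    unfolding borel_def
  proof (intro CollectI conjI)
    show "upper_triangular b"
      using wtri b by (intro upper_triangularI) (auto simp: b_def)
    show "b * ?F * b\<^sup>T = ?F"
    proof (rule eq_matI)
      fix i j
      assume "i < dim_row ?F" "j < dim_col ?F"
      then show "(b * ?F * b\<^sup>T) $$ (i, j) = ?F $$ (i, j)"
        using carrier_matD[OF symplectic_form_carrier[of l]]
        by (simp add: idx[OF symplectic_form_carrier] om del: index_mult_mat(1))
    qed (use b carrier_matD[OF symplectic_form_carrier[of l]] in auto)
  qed fact
  moreover have "bil S (w p) (w k) = (if k = \<sigma> p then 1 else 0)" if "p \<in> P" "k < ?n" for p k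
  proof -
    consider "k \<in> P" | q where "q \<in> P" "k = opp l q" | "?R k"
      using kinds[OF \<open>k < ?n\<close>] by blast
    then show ?thesis
    proof cases
      case 1
      then show ?thesis using that gram by (simp add: wP)
    next
      case (2 q)
      then show ?thesis
        using comm[of "w p" "w k"] bil_sharp_radical[OF S] P(2)[OF \<open>q \<in> P\<close>] \<sigma>(1)[OF that(1)]
        by (auto simp: wQ bil_linear)
    next
      case 3
      then show ?thesis
        using comm[of "w p" "w k"] RuS[OF 3 that(1)] \<sigma>(1)[OF that(1)] that by (auto simp: wP)
    qed
  qed
  moreover have "bil S (w (opp l p)) (w k) = 0" if "p \<in> P" for p k
    using that by (simp add: wQ bil_linear bil_sharp_radical[OF S])
  moreover have "bil S (w k) (w m) = S $$ (k, m)"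
    if R: "?R k" "?R m" and 0: "\<And>p. p \<in> P \<Longrightarrow> bil S (delta k) (u p) = 0" for k m
  proof -
    \<comment> \<open>Nothing is subtracted from \<open>delta k\<close>, and the terms subtracted
      from \<open>delta m\<close> are orthogonal to \<open>delta k\<close>.\<close>
    have "w k = delta k"
      using 0 \<sigma>(1) by (simp add: wR[OF R(1)])
    then have "bil S (w k) (w m) = bil S (delta k) (delta m)"
      using 0 by (simp add: wR[OF R(2)] bil_linear)
    then show ?thesis using R Sc by (simp add: bil_delta_delta)
  qed
  ultimately show ?thesis
    using that Pn by (simp add: idx[OF Sc] del: index_mult_mat(1))
qed

section \<open>The Borel subgroup\<close>

lemma symplectic_mult_index:
  assumes "A \<in> carrier_mat (2 * l) m" "i < 2 * l" "j < m"
  shows "(symplectic_form l * A) $$ (i, j) = sg l i * A $$ (opp l i, j)"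
proof -
  have "(symplectic_form l * A) $$ (i, j)
      = (\<Sum>r<2 * l. if r = opp l i then sg l i * A $$ (r, j) else 0)"
    unfolding mult_mat_index[OF symplectic_form_carrier assms]
    using assms by (intro sum.cong) (auto simp: symplectic_form_index)
  then show ?thesis using assms by simp
qed

lemma mult_assoc_dim:
  fixes A B C :: "'a :: semiring_0 mat"
  assumes "dim_col A = dim_row B" "dim_col B = dim_row C"
  shows "A * B * C = A * (B * C)"
  using assms by (intro assoc_mult_mat[of _ "dim_row A" "dim_row B" _ "dim_row C" _ "dim_col C"]) auto

lemma transpose_mult_dim:
  fixes A B :: "'a :: comm_semiring_0 mat"
  assumes "dim_col A = dim_row B"
  shows "(A * B)\<^sup>T = B\<^sup>T * A\<^sup>T"
  using assms by (intro transpose_mult[of _ "dim_row A" "dim_row B" _ "dim_col B"]) auto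

lemma symplectic_form_dim [simp]:
  "dim_row (symplectic_form l) = 2 * l" "dim_col (symplectic_form l) = 2 * l"
  using carrier_matD[OF symplectic_form_carrier] by auto

lemma symplectic_form_cancel [simp]:
  assumes "dim_row A = 2 * l"
  shows "symplectic_form l * (symplectic_form l * A) = - A"
proof -
  have "symplectic_form l * (symplectic_form l * A) = (- 1\<^sub>m (2 * l)) * A"
    using assms by (simp add: mult_assoc_dim[symmetric] symplectic_form_square)
  then show ?thesis
    using assms by simp
qed

text \<open>The inverse of \<open>b\<close>, read off from \<open>b F b^T = F\<close> and
  \<open>F F = -1\<close>.\<close>

definition inv_borel :: "nat \<Rightarrow> complex mat \<Rightarrow> complex mat" where
  "inv_borel l b = - (symplectic_form l * (b\<^sup>T * symplectic_form l))"

lemma inv_borel_carrier [simp]: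
  "b \<in> carrier_mat (2 * l) (2 * l) \<Longrightarrow> inv_borel l b \<in> carrier_mat (2 * l) (2 * l)"
  by (intro carrier_matI) (auto simp: inv_borel_def)

lemma inv_borel_dim [simp]:
  "dim_row (inv_borel l b) = 2 * l" "dim_col (inv_borel l b) = 2 * l"
  by (auto simp: inv_borel_def)

lemma mult_inv_borel_right:
  assumes "b \<in> carrier_mat (2 * l) (2 * l)" "b * symplectic_form l * b\<^sup>T = symplectic_form l"
  shows "b * inv_borel l b = 1\<^sub>m (2 * l)" "inv_borel l b * b = 1\<^sub>m (2 * l)"
proof -
  let ?F = "symplectic_form l" and ?n = "2 * l"
  have "b * inv_borel l b = - (b * ?F * b\<^sup>T * ?F)"
    using assms(1) by (simp add: inv_borel_def mult_assoc_dim)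
  also have "\<dots> = 1\<^sub>m ?n"
    by (simp add: assms(2) symplectic_form_square)
  finally show "b * inv_borel l b = 1\<^sub>m ?n" .
  then show "inv_borel l b * b = 1\<^sub>m ?n"
    by (rule mat_mult_left_right_inverse[OF assms(1) inv_borel_carrier[OF assms(1)]])
qed

text \<open>A right inverse of a square matrix is a left inverse, and
  \<open>inv_borel l b * b = 1\<close> is the transposed relation up to a factor \<open>F\<close>.
  The converse is the same argument for \<open>b\<^sup>T\<close>.\<close>

lemma symplectic_transpose_iff:
  assumes b: "b \<in> carrier_mat (2 * l) (2 * l)"
  shows "b\<^sup>T * symplectic_form l * b = symplectic_form l
     \<longleftrightarrow> b * symplectic_form l * b\<^sup>T = symplectic_form l"
proof -
  let ?F = "symplectic_form l" and ?n = "2 * l"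
  have 1: "b\<^sup>T * ?F * b = ?F" if b: "b \<in> carrier_mat ?n ?n" "b * ?F * b\<^sup>T = ?F" for b
  proof -
    have "b\<^sup>T * ?F * b = ?F * (inv_borel l b * b)"
      using b(1) by (simp add: inv_borel_def mult_assoc_dim)
    also have "\<dots> = ?F"
      unfolding mult_inv_borel_right(2)[OF b] by simp
    finally show ?thesis .
  qed
  have 2: "b * ?F * b\<^sup>T = ?F" if "b\<^sup>T * ?F * b = ?F"
    using 1[of "b\<^sup>T"] that b by simp
  show ?thesis
    using 1[OF b] 2 by blast
qed

lemma borelD:
  assumes "b \<in> borel l"
  shows "b \<in> carrier_mat (2 * l) (2 * l)" "b * symplectic_form l * b\<^sup>T = symplectic_form l"
    "\<And>i j. j < i \<Longrightarrow> i < 2 * l \<Longrightarrow> b $$ (i, j) = 0"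
  using assms by (auto simp: borel_def)

lemma one_borel: "1\<^sub>m (2 * l) \<in> borel l"
  using left_mult_one_mat[OF symplectic_form_carrier] right_mult_one_mat[OF symplectic_form_carrier]
  by (simp add: borel_def)

lemma mult_borel:
  assumes "b \<in> borel l" "c \<in> borel l"
  shows "b * c \<in> borel l"
proof -
  let ?F = "symplectic_form l" and ?n = "2 * l"
  note b = borelD[OF assms(1)] and c = borelD[OF assms(2)]
  have "b * c * ?F * (b * c)\<^sup>T = b * (c * ?F * c\<^sup>T) * b\<^sup>T"
    using b(1) c(1) by (simp add: transpose_mult_dim mult_assoc_dim)
  also have "\<dots> = ?F"
    by (simp add: c b)
  finally have "b * c * ?F * (b * c)\<^sup>T = ?F" .
  moreover have "upper_triangular (b * c)"
  proof (rule upper_triangularI)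
    fix i j
    assume ij: "j < i" "i < dim_row (b * c)"
    then have "(b * c) $$ (i, j) = (\<Sum>r<?n. b $$ (i, r) * c $$ (r, j))"
      using b(1) c(1) by (intro mult_mat_index[OF b(1) c(1)]) auto
    also have "\<dots> = 0"
    proof (rule sum.neutral, rule ballI)
      fix r
      assume "r \<in> {..<?n}"
      then show "b $$ (i, r) * c $$ (r, j) = 0"
        using ij b c by (cases "r < i") auto
    qed
    finally show "(b * c) $$ (i, j) = 0" .
  qed
  ultimately show ?thesis
    using b(1) c(1) by (simp add: borel_def)
qed

lemma inv_borel:
  assumes "b \<in> borel l"
  shows "inv_borel l b \<in> borel l"
proof -
  let ?F = "symplectic_form l" and ?n = "2 * l" and ?c = "inv_borel l b"
  note b = borelD[OF assms]
  have c: "?c \<in> carrier_mat ?n ?n"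
    using b(1) by simp
  have "?c * ?F * ?c\<^sup>T = ?c * (b * ?F * b\<^sup>T) * ?c\<^sup>T"
    by (simp add: b)
  also have "\<dots> = (?c * b) * ?F * (?c * b)\<^sup>T"
    using b(1) c by (simp add: transpose_mult_dim mult_assoc_dim)
  also have "\<dots> = ?F"
    by (simp add: mult_inv_borel_right[OF b(1,2)])
  finally have "?c * ?F * ?c\<^sup>T = ?F" .
  moreover have "upper_triangular ?c"
  proof (rule upper_triangularI)
    fix i j
    assume ij: "j < i" "i < dim_row ?c"
    then have n: "i < ?n" "j < ?n"
      using c by auto
    \<comment> \<open>Up to signs the inverse is \<open>b\<close> reflected in the antidiagonal,
      which preserves upper triangularity.\<close>
    have "?c $$ (i, j) = - (sg l i * (- sg l j * b $$ (opp l j, opp l i)))"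
      using b(1) n mult_carrier_mat[OF transpose_carrier_mat[THEN iffD2, OF b(1)] symplectic_form_carrier]
      by (simp add: inv_borel_def symplectic_mult_index[where m = ?n]
          mult_symplectic_index[where m = ?n] del: index_mult_mat(1))
    also have "\<dots> = 0"
      using ij n b(3)[of "opp l i" "opp l j"] by (auto simp: opp_def)
    finally show "?c $$ (i, j) = 0" .
  qed
  ultimately show ?thesis
    using c by (simp add: borel_def)
qed

lemma borel_diagonal:
  assumes "b \<in> borel l" "q < 2 * l"
  shows "b $$ (q, q) \<noteq> 0"
proof -
  note b = borelD[OF assms(1)] and c = borelD[OF inv_borel[OF assms(1)]]
  have "(\<Sum>r<2 * l. b $$ (q, r) * inv_borel l b $$ (r, q)) = 1"
    using mult_mat_index[OF b(1) c(1) assms(2) assms(2)] mult_inv_borel_right(1)[OF b(1,2)] assms(2)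
    by simp
  moreover have "(\<Sum>r<2 * l. b $$ (q, r) * inv_borel l b $$ (r, q))
      = (\<Sum>r<2 * l. if r = q then b $$ (q, q) * inv_borel l b $$ (q, q) else 0)"
  proof (rule sum.cong)
    fix r
    assume "r \<in> {..<2 * l}"
    then show "b $$ (q, r) * inv_borel l b $$ (r, q)
        = (if r = q then b $$ (q, q) * inv_borel l b $$ (q, q) else 0)"
      using b(3)[of r q] c(3)[of q r] assms(2) by (cases r q rule: linorder_cases) auto
  qed simp
  ultimately show ?thesis
    using assms(2) by auto
qed

lemma congruence_congruence:
  fixes b c S :: "'a :: comm_semiring_0 mat"
  assumes "b \<in> carrier_mat n n" "c \<in> carrier_mat n n" "S \<in> carrier_mat n n"
  shows "c * (b * S * b\<^sup>T) * c\<^sup>T = (c * b) * S * (c * b)\<^sup>T"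
  using assms by (simp add: transpose_mult_dim mult_assoc_dim)

lemma congruence_inv_borel:
  assumes "b \<in> borel l" "S \<in> carrier_mat (2 * l) (2 * l)"
  shows "inv_borel l b * (b * S * b\<^sup>T) * (inv_borel l b)\<^sup>T = S"
  unfolding congruence_congruence[OF borelD(1)[OF assms(1)] inv_borel_carrier[OF borelD(1)[OF assms(1)]] assms(2)]
    mult_inv_borel_right(2)[OF borelD(1,2)[OF assms(1)]]
  using assms(2) by simp

lemma congruence_sym_forms:
  assumes "b \<in> borel l" "S \<in> sym_forms l"
  shows "b * S * b\<^sup>T \<in> sym_forms l"
proof -
  let ?F = "symplectic_form l" and ?n = "2 * l"
  note b = borelD[OF assms(1)]
  have S: "S \<in> carrier_mat ?n ?n" "S\<^sup>T = S" "S * ?F * S = 0\<^sub>m ?n ?n"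
    using assms(2) by (auto simp: sym_forms_def)
  have bF: "b\<^sup>T * ?F * b = ?F"
    using symplectic_transpose_iff[OF b(1)] b(2) by blast
  have "(b * S * b\<^sup>T)\<^sup>T = b * S * b\<^sup>T"
    using b(1) S(1,2)
    by (simp add: transpose_mult_dim mult_assoc_dim)
  moreover have "b * S * b\<^sup>T * ?F * (b * S * b\<^sup>T) = b * (S * (b\<^sup>T * ?F * b) * S) * b\<^sup>T"
    using b(1) S(1) by (simp add: mult_assoc_dim)
  ultimately show ?thesis
    using b(1) S by (simp add: sym_forms_def bF)
qed

text \<open>Compare the entries at \<open>(p, q)\<close> in \<open>b^-1 N' = N b^T\<close>. On the
  right it is the diagonal entry \<open>b $$ (q, q)\<close>, which is nonzero; on the left only rows
  \<open>r\<close> with \<open>p \<le> r\<close> of \<open>N'\<close> contribute.\<close>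

lemma borel_row_dominance:
  assumes b: "b \<in> borel l"
    and N: "N \<in> carrier_mat (2 * l) (2 * l)" and N': "N' = b * N * b\<^sup>T"
    and p: "p < 2 * l" and q: "q < 2 * l"
    and row: "\<And>r. r < 2 * l \<Longrightarrow> N $$ (p, r) = (if r = q then 1 else 0)"
  shows "\<exists>r<2 * l. p \<le> r \<and> N' $$ (r, q) \<noteq> 0"
proof (rule ccontr)
  let ?n = "2 * l" and ?c = "inv_borel l b"
  note bD = borelD[OF b] and cD = borelD[OF inv_borel[OF b]]
  assume "\<not> ?thesis"
  then have 0: "N' $$ (r, q) = 0" if "r < ?n" "p \<le> r" for r
    using that by auto
  have N'c: "N' \<in> carrier_mat ?n ?n"
    using bD(1) N by (simp add: N')
  have "?c * N' = (?c * b) * N * b\<^sup>T"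
    using bD(1) N by (simp add: N' mult_assoc_dim)
  then have "?c * N' = N * b\<^sup>T"
    using N by (simp add: mult_inv_borel_right[OF bD(1,2)])
  then have "(\<Sum>r<?n. ?c $$ (p, r) * N' $$ (r, q)) = (\<Sum>r<?n. N $$ (p, r) * b\<^sup>T $$ (r, q))"
    using mult_mat_index[OF cD(1) N'c p q] mult_mat_index[OF N transpose_carrier_mat[THEN iffD2, OF bD(1)] p q]
    by simp
  also have "\<dots> = (\<Sum>r<?n. if r = q then b $$ (q, q) else 0)"
    using bD(1) q by (intro sum.cong) (auto simp: row)
  also have "\<dots> = b $$ (q, q)"
    using q by simp
  also have "(\<Sum>r<?n. ?c $$ (p, r) * N' $$ (r, q)) = 0"
  proof (rule sum.neutral, rule ballI)
    fix r
    assume "r \<in> {..<?n}"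
    then show "?c $$ (p, r) * N' $$ (r, q) = 0"
      using 0 cD(3)[of r p] p by (cases "r < p") auto
  qed
  finally show False
    using borel_diagonal[OF b q] by simp
qed

section \<open>Reduction to partial permutation matrices\<close>

text \<open>The bound \<open>q\<close> in \<open>D\<close> decouples the finished rows from the
  rest. For symmetric \<open>S\<close> and all indices in \<open>D\<close>, this means a partial
  permutation matrix.\<close>

definition settled :: "nat \<Rightarrow> complex mat \<Rightarrow> nat set \<Rightarrow> bool" where
  "settled l S D \<longleftrightarrow> (\<forall>p\<in>D. (\<forall>r<2 * l. S $$ (p, r) = 0)
     \<or> (\<exists>q\<in>D. \<forall>r<2 * l. S $$ (p, r) = (if r = q then 1 else 0)))"

text \<open>\<open>pivot_basis\<close> is applied to one pivot pair; \<open>D\<close> grows by the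
  pivots, whose rows become unit vectors, and by their opposites, whose rows become zero.\<close>

lemma settle_step:
  assumes S: "S \<in> sym_forms l"
    and D: "D \<subseteq> {..<2 * l}" "\<And>k. k \<in> D \<Longrightarrow> opp l k \<in> D" "settled l S D"
    and ex: "k0 < 2 * l" "k0 \<notin> D" "m0 < 2 * l" "S $$ (k0, m0) \<noteq> 0"
  obtains b D' where "b \<in> borel l" "D \<subset> D'" "D' \<subseteq> {..<2 * l}"
    "\<And>k. k \<in> D' \<Longrightarrow> opp l k \<in> D'" "settled l (b * S * b\<^sup>T) D'"
proof -
  let ?n = "2 * l"
  note Sc = sym_formsD(1)[OF S] and sym = sym_formsD(2)[OF S]
  have Sd: "dim_row S = ?n" "dim_col S = ?n"
    using Sc by auto
  have outD: "S $$ (k, m) = 0" if "k \<in> D" "m < ?n" "m \<notin> D" for k m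
    using D(3) that unfolding settled_def by metis
  define I where "I = {i \<in> {..<?n} - D. \<exists>j<?n. S $$ (i, j) \<noteq> 0}"
  \<comment> \<open>The last unfinished nonzero row, and below its last nonzero column
    \<open>j\<close>, are chosen so that \<open>S\<close> vanishes beyond the pivot; this is what
    \<open>dom\<close> requires.\<close>
  define i where "i = Max I"
  have I: "finite I" "I \<noteq> {}"
    using ex by (auto simp: I_def)
  have "i \<in> I"
    unfolding i_def using I by (rule Max_in)
  then have i: "i < ?n" "i \<notin> D" and exj: "\<exists>j<?n. S $$ (i, j) \<noteq> 0"
    by (auto simp: I_def)
  have rowzero: "S $$ (k, m) = 0" if "i < k" "k < ?n" "k \<notin> D" "m < ?n" for k m
  proof (rule ccontr)
    assume "S $$ (k, m) \<noteq> 0"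
    then have "k \<in> I"
      using that by (auto simp: I_def)
    from Max_ge[OF I(1) this] that(1) show False
      by (simp add: i_def)
  qed
  define J where "J = {j. j < ?n \<and> S $$ (i, j) \<noteq> 0}"
  define j where "j = Max J"
  have J: "finite J" "J \<noteq> {}"
    using exj by (auto simp: J_def)
  have "j \<in> J"
    unfolding j_def using J by (rule Max_in)
  then have j: "j < ?n" and c: "S $$ (i, j) \<noteq> 0"
    by (auto simp: J_def)
  have colzero: "S $$ (i, m) = 0" if "j < m" "m < ?n" for m
  proof (rule ccontr)
    assume "S $$ (i, m) \<noteq> 0"
    then have "m \<in> J"
      using that by (auto simp: J_def)
    from Max_ge[OF J(1) this] that(1) show False
      by (simp add: j_def)
  qed
  have jD: "j \<notin> D"
    using outD[of j i] c i j sym[of i j] by auto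
  have ji: "j \<le> i"
    using rowzero[of j i] c i j jD sym[of i j] by force
  have below: "S $$ (k, m) = 0" if "i < k" "k < ?n" "m = i \<or> m = j" for k m
    using that rowzero[of k m] outD[of k m] i j jD by (cases "k \<in> D") auto
  \<comment> \<open>Otherwise maximality of \<open>i\<close> and \<open>j\<close> leaves only the
    term \<open>r = j\<close> in the sum for the \<open>(i, j)\<close> entry of
    \<open>S F S\<close>, and that term is plus or minus the square of
    \<open>S $$ (i, j)\<close>.\<close>
  have "opp l i \<noteq> j"
  proof
    assume eq: "opp l i = j"
    have "(\<Sum>r<?n. S $$ (r, i) * sg l r * S $$ (opp l r, j)) = 0"
      using sym_formsD(3)[OF S, of "delta i" "delta j"] i j
      by (simp add: bil_symplectic bil_delta_delta Sd cong: sum.cong_simp)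
    moreover have "(\<Sum>r<?n. S $$ (r, i) * sg l r * S $$ (opp l r, j))
        = (\<Sum>r<?n. if r = j then S $$ (j, i) * sg l j * S $$ (i, j) else 0)"
    proof (rule sum.cong)
      fix r
      assume "r \<in> {..<?n}"
      then have r: "r < ?n"
        by simp
      have "opp l j = i"
        using eq i by auto
      moreover have "S $$ (r, i) = 0" if "j < r"
        using colzero[OF that r] sym[OF i(1) r] by simp
      moreover have "S $$ (opp l r, j) = 0" if "r < j"
        using that r eq i by (intro below) (auto simp: opp_def)
      ultimately show "S $$ (r, i) * sg l r * S $$ (opp l r, j)
          = (if r = j then S $$ (j, i) * sg l j * S $$ (i, j) else 0)"
        by (cases r j rule: linorder_cases) auto
    qed simp
    ultimately show False
      using c j sym[OF i(1) j] by simp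
  qed
  then have oij: "opp l i \<noteq> j" "opp l j \<noteq> i" "opp l i \<noteq> i" "opp l j \<noteq> j"
    using i j by auto
  define P where "P = {i, j}"
  define \<sigma> where "\<sigma> p = (if p = i then j else i)" for p
  \<comment> \<open>A single pivot is normalised by a square root. For \<open>i \<noteq> j\<close>
    the diagonal entry at \<open>i\<close> vanishes, and half of \<open>S $$ (j, j)\<close> is
    removed on each side to make \<open>u j\<close> isotropic; since \<open>j < i\<close>, adding a
    multiple of \<open>delta i\<close> keeps it triangular.\<close>
  define u where "u p = (if i = j then (\<lambda>r. (1 / csqrt (S $$ (i, i))) * delta i r)
     else if p = i then (\<lambda>r. (1 / S $$ (i, j)) * delta i r)
     else (\<lambda>r. delta j r - (S $$ (j, j) / (2 * S $$ (i, j))) * delta i r))" for p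
  have Su: "bil S (delta k) (u p) = 0"
    if "k < ?n" "S $$ (k, i) = 0" "S $$ (k, j) = 0" for k p
    using that i j by (simp add: u_def bil_linear bil_delta_delta Sd)
  have PD: "p \<notin> D" "opp l p \<notin> D" "p < ?n" if "p \<in> P" for p
    using that i jD j D(2)[of "opp l p"] by (auto simp: P_def)
  have P: "P \<subseteq> {..<?n}" "\<And>p. p \<in> P \<Longrightarrow> opp l p \<notin> P"
    using i j oij by (auto simp: P_def)
  have \<sigma>: "\<And>p. p \<in> P \<Longrightarrow> \<sigma> p \<in> P" "\<And>p. p \<in> P \<Longrightarrow> \<sigma> (\<sigma> p) = p"
    by (auto simp: P_def \<sigma>_def)
  have gram: "bil S (u p) (u q) = (if q = \<sigma> p then 1 else 0)" if "p \<in> P" "q \<in> P" for p q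
  proof (cases "i = j")
    case True
    have "csqrt (S $$ (i, i)) * csqrt (S $$ (i, i)) = S $$ (i, i)"
      using power2_csqrt[of "S $$ (i, i)"] by (simp add: power2_eq_square)
    then show ?thesis
      using that True i c by (simp add: P_def \<sigma>_def u_def bil_linear bil_delta_delta Sd)
  next
    case False
    then have "S $$ (i, i) = 0"
      using colzero[of i] ji i by simp
    then show ?thesis
      using that False i j c sym[OF i(1) j]
      by (auto simp: P_def \<sigma>_def u_def bil_linear bil_delta_delta Sd)
  qed
  have supp: "u p r = 0" if "p \<in> P" "r \<notin> P" for p r
    using that by (auto simp: u_def P_def delta_def)
  have tri: "u p r = 0" if "p \<in> P" "r < p" for p r
    using that ji by (auto simp: u_def P_def delta_def)
  have dom: "bil S (delta k) (u (\<sigma> p)) = 0" if "p \<in> P" "p < k" "k < ?n" for p k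
  proof (cases "i < k")
    case True
    then show ?thesis
      using that by (intro Su below) auto
  next
    case False
    then have "p = j" "i \<noteq> j" "\<sigma> p = i"
      using that by (auto simp: P_def \<sigma>_def)
    then show ?thesis
      using that colzero[of k] sym[of k i] i by (simp add: u_def bil_linear bil_delta_delta Sd)
  qed
  obtain b where b: "b \<in> borel l"
    and b1: "\<And>p k. p \<in> P \<Longrightarrow> k < ?n \<Longrightarrow> (b * S * b\<^sup>T) $$ (p, k) = (if k = \<sigma> p then 1 else 0)"
    and b2: "\<And>p k. p \<in> P \<Longrightarrow> k < ?n \<Longrightarrow> (b * S * b\<^sup>T) $$ (opp l p, k) = 0"
    and b3: "\<And>k m. k < ?n \<Longrightarrow> m < ?n \<Longrightarrow> k \<notin> P \<Longrightarrow> opp l k \<notin> P \<Longrightarrow> m \<notin> P \<Longrightarrow> opp l m \<notin> P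
      \<Longrightarrow> (\<And>p. p \<in> P \<Longrightarrow> bil S (delta k) (u p) = 0) \<Longrightarrow> (b * S * b\<^sup>T) $$ (k, m) = S $$ (k, m)"
    using pivot_basis[OF S P \<sigma> gram supp tri dom] by blast
  define S' where "S' = b * S * b\<^sup>T"
  note sym' = sym_formsD(2)[OF congruence_sym_forms[OF b S], folded S'_def]
  define D' where "D' = D \<union> P \<union> opp l ` P"
  \<comment> \<open>Rows in \<open>D\<close> vanish at \<open>i\<close> and \<open>j\<close>, so
    they are orthogonal to the pivot vectors and \<open>b3\<close> applies; in the pivot columns and
    their opposites both sides are zero.\<close>
  have rowD: "S' $$ (k, m) = S $$ (k, m)" if k: "k \<in> D" and m: "m < ?n" for k m
  proof -
    have kn: "k < ?n"
      using k D(1) by auto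
    have kP: "k \<notin> P" "opp l k \<notin> P"
      using k PD D(2) by auto
    consider "m \<in> P" | q where "q \<in> P" "m = opp l q" | "m \<notin> P" "opp l m \<notin> P"
      using m by (metis opp_opp)
    then show ?thesis
    proof cases
      case 1
      then have "S' $$ (m, k) = 0"
        using b1[of m k] kn kP \<sigma>(1)[of m] by (auto simp: S'_def)
      then show ?thesis
        using outD[OF k m] PD(1)[OF 1] sym'[OF kn m] by simp
    next
      case (2 q)
      then have "S' $$ (m, k) = 0"
        using b2[of q k] kn by (auto simp: S'_def)
      then show ?thesis
        using outD[OF k m] PD(2)[OF 2(1)] 2(2) sym'[OF kn m] by simp
    next
      case 3
      then show ?thesis
        unfolding S'_def using kn m kP outD[OF k] i j jD by (intro b3 Su) auto
    qed
  qed
  have "settled l S' D'"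
    unfolding settled_def
  proof
    fix p
    assume "p \<in> D'"
    then consider "p \<in> D" | "p \<in> P" | q where "q \<in> P" "p = opp l q"
      by (auto simp: D'_def)
    then show "(\<forall>r<?n. S' $$ (p, r) = 0)
      \<or> (\<exists>q\<in>D'. \<forall>r<?n. S' $$ (p, r) = (if r = q then 1 else 0))"
    proof cases
      case 1
      then consider "\<forall>r<?n. S $$ (p, r) = 0"
        | q where "q \<in> D" "\<forall>r<?n. S $$ (p, r) = (if r = q then 1 else 0)"
        using D(3) unfolding settled_def by blast
      then show ?thesis
        using rowD[OF 1] by cases (auto simp: D'_def)
    next
      case 2
      have "\<sigma> p \<in> D'"
        using \<sigma>(1)[OF 2] by (simp add: D'_def)
      moreover have "\<forall>r<?n. S' $$ (p, r) = (if r = \<sigma> p then 1 else 0)"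
        using b1[OF 2] by (simp add: S'_def)
      ultimately show ?thesis
        by blast
    next
      case 3
      then show ?thesis
        using b2 by (auto simp: S'_def)
    qed
  qed
  moreover have "D \<subset> D'"
    using i(2) by (auto simp: D'_def P_def)
  moreover have "D' \<subseteq> {..<?n}"
    using D(1) P(1) PD(3) by (auto simp: D'_def)
  moreover have "opp l k \<in> D'" if "k \<in> D'" for k
    using that D(2) PD(3) by (auto simp: D'_def)
  ultimately show ?thesis
    using that b by (simp add: S'_def)
qed

text \<open>Induction on the number of indices outside \<open>D\<close>. When the rows outside
  \<open>D\<close> all vanish, \<open>D\<close> may be replaced by the set of all indices.\<close>

lemma settle_from:
  assumes "S \<in> sym_forms l" "D \<subseteq> {..<2 * l}" "\<And>k. k \<in> D \<Longrightarrow> opp l k \<in> D" "settled l S D"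
  shows "\<exists>b\<in>borel l. settled l (b * S * b\<^sup>T) {..<2 * l}"
  using assms
proof (induction "card ({..<2 * l} - D)" arbitrary: S D rule: less_induct)
  case less
  note S = sym_formsD(1)[OF less.prems(1)]
  show ?case
  proof (cases "\<exists>k m. k < 2 * l \<and> k \<notin> D \<and> m < 2 * l \<and> S $$ (k, m) \<noteq> 0")
    case True
    then obtain k m where km: "k < 2 * l" "k \<notin> D" "m < 2 * l" "S $$ (k, m) \<noteq> 0"
      by blast
    obtain b D' where b: "b \<in> borel l" and D': "D \<subset> D'" "D' \<subseteq> {..<2 * l}"
      "\<And>k. k \<in> D' \<Longrightarrow> opp l k \<in> D'" "settled l (b * S * b\<^sup>T) D'"
      using settle_step[OF less.prems km] by blast
    have "card ({..<2 * l} - D') < card ({..<2 * l} - D)"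
      using D'(1,2) by (intro psubset_card_mono) auto
    then obtain c where c: "c \<in> borel l" "settled l (c * (b * S * b\<^sup>T) * c\<^sup>T) {..<2 * l}"
      using less.hyps[OF _ congruence_sym_forms[OF b less.prems(1)] D'(2-4)] by blast
    then show ?thesis
      using mult_borel[OF c(1) b] congruence_congruence[OF borelD(1)[OF b] borelD(1)[OF c(1)] S]
      by auto
  next
    case False
    then have "settled l S {..<2 * l}"
      using less.prems(2,4) unfolding settled_def by (metis lessThan_iff subsetD)
    then show ?thesis
      using one_borel[of l] S by (intro bexI[of _ "1\<^sub>m (2 * l)"]) auto
  qed
qed

lemma settle:
  assumes "S \<in> sym_forms l"
  shows "\<exists>b\<in>borel l. settled l (b * S * b\<^sup>T) {..<2 * l}"
  using settle_from[OF assms, of "{}"] by (simp add: settled_def)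

lemma settledE:
  assumes "settled l S {..<2 * l}" "p < 2 * l" "q < 2 * l" "S $$ (p, q) \<noteq> 0" "r < 2 * l"
  shows "S $$ (p, r) = (if r = q then 1 else 0)"
  using assms unfolding settled_def by (metis lessThan_iff)

text \<open>
  Row dominance for \<open>b\<close> and for its inverse moves the entry \<open>1\<close> of a column down and back down, so
  it cannot move at all.
\<close>

lemma settled_congruent_support:
  assumes S: "S \<in> sym_forms l" "settled l S {..<2 * l}"
    and b: "b \<in> borel l" and S': "settled l (b * S * b\<^sup>T) {..<2 * l}"
    and pq: "p < 2 * l" "q < 2 * l" "S $$ (p, q) \<noteq> 0"
  shows "(b * S * b\<^sup>T) $$ (p, q) \<noteq> 0"
proof -
  let ?n = "2 * l"
  define N where "N = b * S * b\<^sup>T"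
  have N: "N \<in> sym_forms l"
    unfolding N_def by (rule congruence_sym_forms[OF b S(1)])
  obtain r where r: "r < ?n" "p \<le> r" "N $$ (r, q) \<noteq> 0"
    using borel_row_dominance[OF b sym_formsD(1)[OF S(1)] N_def pq(1,2) settledE[OF S(2) pq]] by blast
  obtain r' where r': "r' < ?n" "r \<le> r'" "S $$ (r', q) \<noteq> 0"
    using borel_row_dominance[OF inv_borel[OF b] sym_formsD(1)[OF N] _ r(1) pq(2)
        settledE[OF S'[folded N_def] r(1) pq(2) r(3)]]
      congruence_inv_borel[OF b sym_formsD(1)[OF S(1)], folded N_def] by metis
  \<comment> \<open>Symmetry turns the two entries of column \<open>q\<close> into entries of row
    \<open>q\<close>, where only one can be nonzero; thus
    \<open>p \<le> r \<le> r' = p\<close>.\<close>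
  have "S $$ (q, p) \<noteq> 0" "S $$ (q, r') \<noteq> 0"
    using pq r' sym_formsD(2)[OF S(1)] by metis+
  then have "r' = p"
    using settledE[OF S(2) pq(2,1) _ r'(1)] by metis
  then show ?thesis
    using r r' by (simp add: N_def)
qed

text \<open>Settled matrices have entries 0 and 1 only, so equality of supports suffices; the two
  inclusions come from \<open>b\<close> and its inverse.\<close>

lemma settled_congruent_unique:
  assumes S: "S \<in> sym_forms l" "settled l S {..<2 * l}"
    and b: "b \<in> borel l" and S': "settled l (b * S * b\<^sup>T) {..<2 * l}"
  shows "b * S * b\<^sup>T = S"
proof (rule eq_matI)
  let ?n = "2 * l"
  note S'' = congruence_sym_forms[OF b S(1)]
  note inv = congruence_inv_borel[OF b sym_formsD(1)[OF S(1)]]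
  fix p q
  assume "p < dim_row S" "q < dim_col S"
  then have pq: "p < ?n" "q < ?n"
    using sym_formsD(1)[OF S(1)] by auto
  have "S $$ (p, q) \<noteq> 0" if "(b * S * b\<^sup>T) $$ (p, q) \<noteq> 0"
    using settled_congruent_support[OF S'' S' inv_borel[OF b] _ pq that, unfolded inv] S(2) by blast
  then have "S $$ (p, q) = 0 \<longleftrightarrow> (b * S * b\<^sup>T) $$ (p, q) = 0"
    using settled_congruent_support[OF S b S' pq] by blast
  then show "(b * S * b\<^sup>T) $$ (p, q) = S $$ (p, q)"
    using settledE[OF S(2) pq _ pq(2)] settledE[OF S' pq _ pq(2)] by metis
qed (use sym_formsD(1)[OF S(1)] borelD(1)[OF b] in auto)

section \<open>Link patterns as matrices\<close>

text \<open>Passes from zero-based indices to one-based vertices: \<open>p\<close> and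
  \<open>opp l p\<close> lie over the same vertex.\<close>

definition vertex :: "nat \<Rightarrow> nat \<Rightarrow> nat" where
  "vertex l p = (if p < l then p + 1 else 2 * l - p)"

lemma vertex_eq_iff:
  "p < 2 * l \<Longrightarrow> q < 2 * l \<Longrightarrow> vertex l p = vertex l q \<longleftrightarrow> q = p \<or> q = opp l p"
  by (auto simp: vertex_def opp_def)

text \<open>
  Vertex \<open>i\<close> owns the zero-based indices \<open>i - 1\<close> and \<open>2l - i\<close>.  An undotted arrow takes the
  first at its source and the second at its target; a dotted arrow takes the same one at both
  ends, and its orientation decides which.
\<close>

fun ends :: "nat \<Rightarrow> arrow \<Rightarrow> nat set" where
  "ends l (Arrow d i j) = (if d then if i < j then {i - 1, j - 1} else {2 * l - i, 2 * l - j}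
     else {i - 1, 2 * l - j})"
| "ends l (Loop d i r) = (if r = Clockwise then {i - 1} else {2 * l - i})"

definition solp_arrows :: "nat \<Rightarrow> arrow set" where
  "solp_arrows l = {a \<in> arrows_on l. \<forall>i r. a \<noteq> Loop False i r}"

lemma solp_arrows_cases:
  assumes "a \<in> solp_arrows l"
  obtains d i j where "a = Arrow d i j" "i \<in> {1..l}" "j \<in> {1..l}" "i \<noteq> j"
    | i r where "a = Loop True i r" "i \<in> {1..l}"
  using assms by (cases a) (auto simp: solp_arrows_def arrows_on_def)

lemma ends_less: "a \<in> solp_arrows l \<Longrightarrow> p \<in> ends l a \<Longrightarrow> p < 2 * l"
  by (erule solp_arrows_cases) (auto split: if_splits)

lemma vertex_image_ends: "a \<in> solp_arrows l \<Longrightarrow> vertex l ` ends l a = touched a"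
  by (erule solp_arrows_cases) (auto simp: vertex_def split: if_splits)

text \<open>An arrow between distinct vertices takes one index over each of them, and a dotted loop
  takes a single index.\<close>

lemma ends_opp: "a \<in> solp_arrows l \<Longrightarrow> p \<in> ends l a \<Longrightarrow> opp l p \<notin> ends l a"
  by (erule solp_arrows_cases) (auto simp: opp_def split: if_splits)

lemma ends_pair:
  assumes "a \<in> solp_arrows l" "p \<in> ends l a"
  obtains q where "ends l a = {p, q}"
proof -
  have "\<exists>x y. ends l a = {x, y}"
    by (cases a) (auto split: if_splits)
  then show ?thesis
    using assms(2) that by fastforce
qed

lemma ends_Arrow_iff:
  assumes "i \<in> {1..l}" "j \<in> {1..l}" "i \<noteq> j"
  shows "i - 1 \<in> ends l (Arrow d i j) \<longleftrightarrow> \<not> d \<or> i < j"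
    and "j - 1 \<in> ends l (Arrow d i j) \<longleftrightarrow> d \<and> i < j"
  using assms by auto

text \<open>The ends determine the touched vertices. Over vertices \<open>i\<close> and
  \<open>j\<close>, the four possible subsets of \<open>{i - 1, j - 1}\<close> contained in the ends
  tell the four arrows apart; over one vertex, the chosen index tells the orientation of the
  loop.\<close>

lemma ends_inj:
  assumes "a \<in> solp_arrows l" "b \<in> solp_arrows l" "ends l a = ends l b"
  shows "a = b"
proof -
  have t: "touched a = touched b"
    using vertex_image_ends assms by metis
  from assms(1) show ?thesis
  proof (cases rule: solp_arrows_cases)
    case a: (1 d i j)
    from assms(2) show ?thesis
    proof (cases rule: solp_arrows_cases)
      case b: (1 d' i' j')
      have e: "ends l (Arrow d i j) = ends l (Arrow d' i' j')"
        using assms(3) unfolding a(1) b(1) .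
      have "i' = i \<and> j' = j \<or> i' = j \<and> j' = i"
        using t unfolding a(1) b(1) by (auto simp: doubleton_eq_iff)
      then show ?thesis
      proof (elim disjE conjE)
        assume "i' = i" "j' = j"
        then have "d = d'"
          using ends_Arrow_iff[OF a(2-4), of d] ends_Arrow_iff[OF a(2-4), of d'] e a(4)
          by (metis linorder_neqE_nat not_less_iff_gr_or_eq)
        with \<open>i' = i\<close> \<open>j' = j\<close> show ?thesis
          by (simp add: a(1) b(1))
      next
        assume "i' = j" "j' = i"
        then have False
          using ends_Arrow_iff[OF a(2-4), of d] ends_Arrow_iff[OF a(3,2) a(4)[symmetric], of d'] e a(4)
          by (metis linorder_neqE_nat not_less_iff_gr_or_eq)
        then show ?thesis ..
      qed
    next
      case b: (2 i' r')
      show ?thesis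
        using t a(4) unfolding a(1) b(1) by auto
    qed
  next
    case a: (2 i r)
    from assms(2) show ?thesis
    proof (cases rule: solp_arrows_cases)
      case b: (1 d' i' j')
      show ?thesis
        using t b(4) unfolding a(1) b(1) by auto
    next
      case b: (2 i' r')
      have "i' = i"
        using t unfolding a(1) b(1) by simp
      then show ?thesis
        using assms(3) a(2) unfolding a(1) b(1) by (cases r; cases r') auto
    qed
  qed
qed

text \<open>Two indices in the same half come from a dotted arrow or loop, two in different halves
  from an undotted arrow. The excluded pair \<open>p\<close>, \<open>opp l p\<close> would be an
  undotted arrow from a vertex to itself.\<close>

lemma ends_surj:
  assumes "p < 2 * l" "q < 2 * l" "q \<noteq> opp l p"
  shows "\<exists>a\<in>solp_arrows l. ends l a = {p, q}"
proof -
  let ?s = "\<lambda>p. 2 * l - p"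
  have *: ?thesis if "a \<in> solp_arrows l" "ends l a = {p, q}" for a
    using that by blast
  consider "p = q" "p < l" | "p = q" "l \<le> p" | "p < q" "q < l" | "q < p" "p < l"
    | "l \<le> p" "p < q" | "l \<le> q" "q < p" | "p < l" "l \<le> q" | "q < l" "l \<le> p"
    by linarith
  then show ?thesis
  proof cases
    case 1
    then show ?thesis
      by (intro *[of "Loop True (p + 1) Clockwise"]) (auto simp: solp_arrows_def arrows_on_def)
  next
    case 2
    then show ?thesis using assms
      by (intro *[of "Loop True (?s p) Counterclockwise"]) (auto simp: solp_arrows_def arrows_on_def)
  next
    case 3
    then show ?thesis
      by (intro *[of "Arrow True (p + 1) (q + 1)"]) (auto simp: solp_arrows_def arrows_on_def)
  next
    case 4
    then show ?thesis
      by (intro *[of "Arrow True (q + 1) (p + 1)"]) (auto simp: solp_arrows_def arrows_on_def)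
  next
    case 5
    then show ?thesis using assms
      by (intro *[of "Arrow True (?s p) (?s q)"]) (auto simp: solp_arrows_def arrows_on_def)
  next
    case 6
    then show ?thesis using assms
      by (intro *[of "Arrow True (?s q) (?s p)"]) (auto simp: solp_arrows_def arrows_on_def)
  next
    case 7
    then show ?thesis using assms
      by (intro *[of "Arrow False (p + 1) (?s q)"])
        (auto simp: solp_arrows_def arrows_on_def opp_def)
  next
    case 8
    then show ?thesis using assms
      by (intro *[of "Arrow False (q + 1) (?s p)"])
        (auto simp: solp_arrows_def arrows_on_def opp_def)
  qed
qed

section \<open>Patterns as symmetric partial permutation matrices\<close>

lemma Solp_altdef:
  "Solp l = {T. T \<subseteq> solp_arrows l \<and>
     (\<forall>a\<in>T. \<forall>b\<in>T. touched a \<inter> touched b \<noteq> {} \<longrightarrow> a = b)}"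
proof -
  have "touched a \<subseteq> {1..l}" if "a \<in> arrows_on l" for a
    using that by (simp add: arrows_on_def)
  then show ?thesis
    unfolding Solp_def solp_arrows_def by blast
qed

text \<open>Comparing unordered sets makes the matrix symmetric and, as \<open>{p, p} = {p}\<close>,
  puts loops on the diagonal.\<close>

definition pattern_form :: "nat \<Rightarrow> arrow set \<Rightarrow> complex mat" where
  "pattern_form l T
     = mat (2 * l) (2 * l) (\<lambda>(p, q). if \<exists>a\<in>T. ends l a = {p, q} then 1 else 0)"

lemma pattern_form_index:
  "p < 2 * l \<Longrightarrow> q < 2 * l
    \<Longrightarrow> pattern_form l T $$ (p, q) = (if \<exists>a\<in>T. ends l a = {p, q} then 1 else 0)"
  by (simp add: pattern_form_def)

lemma pattern_form_carrier [simp]: "pattern_form l T \<in> carrier_mat (2 * l) (2 * l)"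
  by (simp add: pattern_form_def)

lemma Solp_vertex_unique:
  assumes "T \<in> Solp l" "a \<in> T" "b \<in> T" "p \<in> ends l a" "q \<in> ends l b" "vertex l p = vertex l q"
  shows "a = b"
proof -
  have "a \<in> solp_arrows l" "b \<in> solp_arrows l"
    using assms by (auto simp: Solp_altdef)
  then have "vertex l p \<in> touched a" "vertex l q \<in> touched b"
    using assms vertex_image_ends by blast+
  then show ?thesis
    using assms by (auto simp: Solp_altdef)
qed

lemma settled_pattern_form:
  assumes "T \<in> Solp l"
  shows "settled l (pattern_form l T) {..<2 * l}"
  unfolding settled_def
proof
  fix p
  assume "p \<in> {..<2 * l}"
  then have p: "p < 2 * l"
    by simp
  show "(\<forall>r<2 * l. pattern_form l T $$ (p, r) = 0)
    \<or> (\<exists>q\<in>{..<2 * l}. \<forall>r<2 * l. pattern_form l T $$ (p, r) = (if r = q then 1 else 0))"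
  proof (cases "\<exists>a\<in>T. p \<in> ends l a")
    case True
    then obtain a where a: "a \<in> T" "p \<in> ends l a"
      by blast
    then have "a \<in> solp_arrows l"
      using assms by (auto simp: Solp_altdef)
    then obtain q where q: "ends l a = {p, q}"
      using ends_pair a(2) by blast
    have "pattern_form l T $$ (p, r) = (if r = q then 1 else 0)" if r: "r < 2 * l" for r
    proof -
      have "r = q" if b: "b \<in> T" "ends l b = {p, r}" for b
      proof -
        have "p \<in> ends l b"
          using b(2) by simp
        then have "a = b"
          using Solp_vertex_unique[OF assms a(1) b(1) a(2)] by simp
        then have "{p, q} = {p, r}"
          using q b(2) by simp
        then show ?thesis
          by (auto simp: doubleton_eq_iff)
      qed
      then have "(\<exists>b\<in>T. ends l b = {p, r}) \<longleftrightarrow> r = q"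
        using a(1) q by blast
      then show ?thesis
        using p r by (simp add: pattern_form_index)
    qed
    moreover have "q < 2 * l"
      using ends_less[OF \<open>a \<in> solp_arrows l\<close>] q by auto
    ultimately show ?thesis
      by blast
  next
    case False
    then show ?thesis
      using p by (auto simp: pattern_form_index)
  qed
qed

text \<open>A nonzero term of \<open>S F S\<close> would give two arrows of \<open>T\<close> ending
  at \<open>r\<close> and \<open>opp l r\<close>. They share a vertex, so they are one arrow,
  contradicting \<open>ends_opp\<close>.\<close>

lemma pattern_form_sym_forms:
  assumes "T \<in> Solp l"
  shows "pattern_form l T \<in> sym_forms l"
proof -
  let ?N = "pattern_form l T" and ?n = "2 * l"
  have sym: "?N\<^sup>T = ?N"
    by (rule eq_matI) (simp_all add: pattern_form_def insert_commute)
  have "?N * symplectic_form l * ?N = ?N * symplectic_form l * ?N\<^sup>T"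
    by (simp add: sym)
  also have "\<dots> = 0\<^sub>m ?n ?n"
  proof (rule eq_matI)
    fix p q
    assume "p < dim_row (0\<^sub>m ?n ?n :: complex mat)" "q < dim_col (0\<^sub>m ?n ?n :: complex mat)"
    then have pq: "p < ?n" "q < ?n"
      by auto
    have "?N $$ (p, r) * sg l r * ?N $$ (q, opp l r) = 0" if r: "r < ?n" for r
    proof (rule ccontr)
      assume "\<not> ?thesis"
      then obtain a b where ab: "a \<in> T" "ends l a = {p, r}" "b \<in> T" "ends l b = {q, opp l r}"
        using pq r by (auto simp: pattern_form_index split: if_splits)
      have "vertex l r = vertex l (opp l r)"
        using vertex_eq_iff[OF r opp_less[OF r]] by simp
      moreover have "r \<in> ends l a" "opp l r \<in> ends l b"
        using ab by simp_all
      ultimately have "a = b" "r \<in> ends l a" "opp l r \<in> ends l a"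
        using Solp_vertex_unique[OF assms ab(1,3)] by blast+
      moreover have "a \<in> solp_arrows l"
        using ab(1) assms by (auto simp: Solp_altdef)
      ultimately show False
        using ends_opp by blast
    qed
    then have "(\<Sum>r<?n. ?N $$ (p, r) * sg l r * ?N $$ (q, opp l r)) = 0"
      by (intro sum.neutral) simp
    then show "(?N * symplectic_form l * ?N\<^sup>T) $$ (p, q) = 0\<^sub>m ?n ?n $$ (p, q)"
      using pq by (simp add: congruence_index[OF symplectic_form_carrier] bil_symplectic
          del: index_mult_mat(1))
  qed (auto simp: pattern_form_def)
  finally show ?thesis
    using sym by (simp add: sym_forms_def)
qed

lemma pattern_form_inj:
  assumes "T \<in> Solp l" "T' \<in> Solp l" "pattern_form l T = pattern_form l T'"
  shows "T = T'"
proof -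
  have "a \<in> T'" if "T \<in> Solp l" "T' \<in> Solp l" "pattern_form l T = pattern_form l T'" "a \<in> T"
    for a T T'
  proof -
    have a: "a \<in> solp_arrows l"
      using that by (auto simp: Solp_altdef)
    have "touched a \<noteq> {}"
      by (cases a) auto
    then obtain p where p: "p \<in> ends l a"
      using vertex_image_ends[OF a] by blast
    then obtain q where q: "ends l a = {p, q}"
      using ends_pair[OF a] by blast
    have pq: "p < 2 * l" "q < 2 * l"
      using ends_less[OF a] q by auto
    have "pattern_form l T' $$ (p, q) = 1"
      unfolding that(3)[symmetric] using that(4) q pq by (auto simp: pattern_form_index)
    then obtain b where "b \<in> T'" "ends l b = {p, q}"
      using pq by (auto simp: pattern_form_index split: if_splits)
    then show ?thesis
      using ends_inj[OF a, of b] q that by (auto simp: Solp_altdef)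
  qed
  from this[OF assms] this[OF assms(2,1) assms(3)[symmetric]] show ?thesis
    by blast
qed

lemma pattern_form_surj:
  assumes S: "S \<in> sym_forms l" "settled l S {..<2 * l}"
  shows "\<exists>T\<in>Solp l. pattern_form l T = S"
proof -
  let ?n = "2 * l"
  note sym = sym_formsD(2)[OF S(1)]
  have Sd: "dim_row S = ?n" "dim_col S = ?n"
    using sym_formsD(1)[OF S(1)] by auto
  \<comment> \<open>Rows \<open>p\<close> and \<open>opp l p\<close> cannot both be nonzero: as row
    \<open>q\<close> is the unit vector at \<open>p\<close>, the \<open>(q, q')\<close> entry of
    \<open>S F S\<close> is a single nonzero term.\<close>
  have opp: False
    if "p < ?n" "q < ?n" "q' < ?n" "S $$ (p, q) \<noteq> 0" "S $$ (opp l p, q') \<noteq> 0" for p q q'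
  proof -
    have "S $$ (q, p) \<noteq> 0"
      using that sym by metis
    note row = settledE[OF S(2) that(2,1) this]
    have "0 = (\<Sum>r<?n. S $$ (r, q) * sg l r * S $$ (opp l r, q'))"
      using sym_formsD(3)[OF S(1), of "delta q" "delta q'"] that(2,3)
      by (simp add: bil_symplectic bil_delta_delta Sd cong: sum.cong_simp)
    also have "\<dots> = (\<Sum>r<?n. if r = p then sg l p * S $$ (opp l p, q') else 0)"
    proof (rule sum.cong)
      fix r
      assume "r \<in> {..<?n}"
      then have "S $$ (r, q) = (if r = p then 1 else 0)"
        using row[of r] sym[OF that(2), of r] by simp
      then show "S $$ (r, q) * sg l r * S $$ (opp l r, q')
          = (if r = p then sg l p * S $$ (opp l p, q') else 0)"
        by simp
    qed simp
    also have "\<dots> = sg l p * S $$ (opp l p, q')"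
      using that(1) by simp
    finally show False
      using that(5) by simp
  qed
  define T where "T = {a \<in> solp_arrows l. \<exists>p q. p < ?n \<and> q < ?n \<and> ends l a = {p, q} \<and> S $$ (p, q) \<noteq> 0}"
  \<comment> \<open>By symmetry of \<open>S\<close>, either end may serve as the row index.\<close>
  have TD: "\<exists>q<?n. ends l a = {p, q} \<and> S $$ (p, q) \<noteq> 0" if "a \<in> T" "p \<in> ends l a" for a p
  proof -
    obtain p' q' where pq: "p' < ?n" "q' < ?n" "ends l a = {p', q'}" "S $$ (p', q') \<noteq> 0"
      using \<open>a \<in> T\<close> by (auto simp: T_def)
    then have "p = p' \<or> p = q'"
      using \<open>p \<in> ends l a\<close> by auto
    then show ?thesis
    proof
      assume "p = q'"
      moreover have "S $$ (q', p') \<noteq> 0"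
        using pq sym by metis
      ultimately show ?thesis
        using pq(1,3) by (auto simp: insert_commute)
    qed (use pq in auto)
  qed
  have "T \<in> Solp l"
    unfolding Solp_altdef
  proof (intro CollectI conjI ballI impI)
    show "T \<subseteq> solp_arrows l"
      by (auto simp: T_def)
    fix a b
    assume ab: "a \<in> T" "b \<in> T" "touched a \<inter> touched b \<noteq> {}"
    then have ab': "a \<in> solp_arrows l" "b \<in> solp_arrows l"
      by (auto simp: T_def)
    obtain p p' where p: "p \<in> ends l a" "p' \<in> ends l b" "vertex l p = vertex l p'"
      using ab(3) by (auto simp flip: vertex_image_ends[OF ab'(1)] vertex_image_ends[OF ab'(2)])
    note pn = ends_less[OF ab'(1) p(1)] ends_less[OF ab'(2) p(2)]
    obtain q where q: "q < ?n" "ends l a = {p, q}" "S $$ (p, q) \<noteq> 0"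
      using TD[OF ab(1) p(1)] by blast
    obtain q' where q': "q' < ?n" "ends l b = {p', q'}" "S $$ (p', q') \<noteq> 0"
      using TD[OF ab(2) p(2)] by blast
    \<comment> \<open>Ends over a common vertex are equal or opposite; the fact \<open>opp\<close>
      rules out the latter.\<close>
    have "p' = p"
      using vertex_eq_iff[OF pn] p(3) opp[OF pn(1) q(1) q'(1) q(3)] q'(3) by auto
    then have "q' = q"
      using settledE[OF S(2) pn(1) q(1) q(3) q'(1)] q'(3) by (auto split: if_splits)
    then show "a = b"
      using ends_inj[OF ab'] q q' \<open>p' = p\<close> by simp
  qed
  moreover have "pattern_form l T = S"
  proof (rule eq_matI)
    fix p q
    assume "p < dim_row S" "q < dim_col S"
    then have pq: "p < ?n" "q < ?n"
      using Sd by auto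
    show "pattern_form l T $$ (p, q) = S $$ (p, q)"
    proof (cases "S $$ (p, q) = 0")
      case True
      have "ends l a \<noteq> {p, q}" if "a \<in> T" for a
        using TD[OF that, of p] True by (auto simp: doubleton_eq_iff)
      then show ?thesis
        using True pq by (auto simp: pattern_form_index)
    next
      case False
      then have "S $$ (q, p) \<noteq> 0"
        using sym pq by metis
      then have "q \<noteq> opp l p"
        using opp[OF pq pq(1) False] by auto
      then obtain a where "a \<in> solp_arrows l" "ends l a = {p, q}"
        using ends_surj[OF pq] by blast
      then have "a \<in> T"
        using False pq by (auto simp: T_def)
      then show ?thesis
        using settledE[OF S(2) pq False pq(2)] pq \<open>ends l a = {p, q}\<close>
        by (auto simp: pattern_form_index)
    qed
  qed (use Sd in \<open>auto simp: pattern_form_def\<close>)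
  ultimately show ?thesis
    by blast
qed

section \<open>Orbits\<close>

lemma carrier_GL:
  "carrier (GL n) = {A \<in> carrier_mat n n. \<exists>B\<in>carrier_mat n n. B * A = 1\<^sub>m n \<and> A * B = 1\<^sub>m n}"
  by (auto simp: GL_def units_of_carrier Units_def ring_mat_simps)

lemma inv_GL:
  assumes "A \<in> carrier_mat n n" "B \<in> carrier_mat n n" "A * B = 1\<^sub>m n" "B * A = 1\<^sub>m n"
  shows "inv\<^bsub>GL n\<^esub> A = B"
proof -
  interpret ring "ring_mat TYPE(complex) n ()"
    by (rule ring_mat)
  have "A \<in> Units (ring_mat TYPE(complex) n ())"
    using assms by (auto simp: Units_def ring_mat_simps)
  then have "inv\<^bsub>GL n\<^esub> A = inv\<^bsub>ring_mat TYPE(complex) n ()\<^esub> A"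
    unfolding GL_def by (rule units_of_inv)
  also have "\<dots> = B"
    using assms by (intro inv_unique'[symmetric]) (simp_all add: ring_mat_simps)
  finally show ?thesis .
qed

lemma carrier_borel_SP: "carrier (borel_SP l) = borel l"
proof (intro Set.set_eqI iffI)
  fix b
  assume "b \<in> carrier (borel_SP l)"
  then show "b \<in> borel l"
    using symplectic_transpose_iff[of b l] by (auto simp: borel_SP_def SP_def carrier_GL borel_def)
next
  fix b
  assume "b \<in> borel l"
  then have b: "b \<in> carrier_mat (2 * l) (2 * l)" "b * symplectic_form l * b\<^sup>T = symplectic_form l"
    "upper_triangular b"
    by (auto simp: borel_def)
  then show "b \<in> carrier (borel_SP l)"
    using symplectic_transpose_iff[OF b(1)] mult_inv_borel_right[OF b(1,2)] inv_borel_carrier[OF b(1)]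
    by (auto simp: borel_SP_def SP_def carrier_GL)
qed

lemma conjugation_borel:
  assumes "b \<in> borel l"
  shows "conjugation (2 * l) b x = b * x * inv_borel l b"
proof -
  note b = borelD(1,2)[OF assms]
  show ?thesis
    unfolding conjugation_def inv_GL[OF b(1) inv_borel_carrier[OF b(1)] mult_inv_borel_right[OF b]] ..
qed

lemma mult_symplectic_cancel:
  assumes "dim_col A = 2 * l"
  shows "A * symplectic_form l * symplectic_form l = - A"
  using assms by (simp add: mult_assoc_dim symplectic_form_square)

lemma mult_symplectic_inj:
  assumes "dim_col A = 2 * l" "dim_col B = 2 * l"
    "A * symplectic_form l = B * symplectic_form l"
  shows "A = B"
proof -
  have "- A = - B"
    unfolding mult_symplectic_cancel[OF assms(1), symmetric] mult_symplectic_cancel[OF assms(2), symmetric]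
      assms(3) ..
  then have "- (- A) = - (- B)"
    by (rule arg_cong)
  then show ?thesis
    by simp
qed

text \<open>From \<open>b^-1 = - F b^T F\<close> and \<open>F F = -1\<close> follows
  \<open>b^-1 F = F b^T\<close>.\<close>

lemma conjugation_borel_form:
  assumes "b \<in> borel l" "x \<in> carrier_mat (2 * l) (2 * l)"
  shows "conjugation (2 * l) b x * symplectic_form l = b * (x * symplectic_form l) * b\<^sup>T"
proof -
  note b = borelD(1)[OF assms(1)]
  have "conjugation (2 * l) b x * symplectic_form l
      = - (b * x * symplectic_form l * b\<^sup>T * symplectic_form l * symplectic_form l)"
    using b assms(2) by (simp add: conjugation_borel[OF assms(1)] inv_borel_def mult_assoc_dim
        symplectic_form_square)
  also have "\<dots> = b * (x * symplectic_form l) * b\<^sup>T"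
    using b assms(2) by (subst mult_symplectic_cancel) (simp_all add: mult_assoc_dim)
  finally show ?thesis .
qed

lemma symplectic_form_transpose: "(symplectic_form l)\<^sup>T = - symplectic_form l"
  by (rule eq_matI) (auto simp: symplectic_form_index opp_eq_iff sg_opp)

lemma uminus_zero_mat [simp]: "- 0\<^sub>m n m = (0\<^sub>m n m :: 'a :: group_add mat)"
  by (rule eq_matI) auto

text \<open>Multiplying the Lie algebra condition by \<open>F\<close> on both sides turns it into
  symmetry of \<open>x F\<close>, as \<open>F\<close> is antisymmetric with square -1. Moreover
  \<open>(x F) F (x F) = - x x F\<close>, and \<open>F\<close> can be cancelled.\<close>

lemma nilpotent2_iff:
  "x \<in> nilpotent2 l \<longleftrightarrow> x \<in> carrier_mat (2 * l) (2 * l) \<and> x * symplectic_form l \<in> sym_forms l"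
proof (cases "x \<in> carrier_mat (2 * l) (2 * l)")
  case x: True
  let ?F = "symplectic_form l" and ?n = "2 * l"
  have "x\<^sup>T * ?F + ?F * x = 0\<^sub>m ?n ?n \<longleftrightarrow> (x * ?F)\<^sup>T = x * ?F"
  proof
    assume sum: "x\<^sup>T * ?F + ?F * x = 0\<^sub>m ?n ?n"
    have neg: "x\<^sup>T * ?F = - (?F * x)"
    proof (rule eq_matI)
      fix i j
      assume "i < dim_row (- (?F * x))" "j < dim_col (- (?F * x))"
      then show "(x\<^sup>T * ?F) $$ (i, j) = (- (?F * x)) $$ (i, j)"
        using x arg_cong[OF sum, of "\<lambda>M. M $$ (i, j)"]
        by (simp add: eq_neg_iff_add_eq_0 del: index_mult_mat(1))
    qed (use x in auto)
    have "- (?F * x\<^sup>T) = ?F * (x\<^sup>T * ?F) * ?F"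
      using x by (simp add: mult_assoc_dim symplectic_form_square)
    also have "\<dots> = x * ?F"
      unfolding neg using x by (simp add: mult_assoc_dim)
    finally show "(x * ?F)\<^sup>T = x * ?F"
      using x by (simp add: transpose_mult_dim symplectic_form_transpose)
  next
    assume "(x * ?F)\<^sup>T = x * ?F"
    then have neg: "- (?F * x\<^sup>T) = x * ?F"
      using x by (simp add: transpose_mult_dim symplectic_form_transpose)
    have "x\<^sup>T * ?F = ?F * (- (?F * x\<^sup>T)) * ?F"
      using x by (simp add: mult_assoc_dim)
    also have "\<dots> = - (?F * x)"
      unfolding neg using x by (simp add: mult_assoc_dim symplectic_form_square)
    finally have "x\<^sup>T * ?F = - (?F * x)" .
    then show "x\<^sup>T * ?F + ?F * x = 0\<^sub>m ?n ?n"
      by (simp only: uminus_l_inv_mat[OF mult_carrier_mat[OF symplectic_form_carrier x]])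
  qed
  moreover have "x ^\<^sub>m 2 = 0\<^sub>m ?n ?n \<longleftrightarrow> x * ?F * ?F * (x * ?F) = 0\<^sub>m ?n ?n"
  proof -
    have "x ^\<^sub>m 2 = x * x"
      using x by (simp add: numeral_2_eq_2)
    moreover have "x * ?F * ?F * (x * ?F) = - (x * x * ?F)"
      using x by (simp add: mult_symplectic_cancel mult_assoc_dim)
    moreover have "x * x = 0\<^sub>m ?n ?n \<longleftrightarrow> - (x * x * ?F) = 0\<^sub>m ?n ?n"
    proof
      assume "- (x * x * ?F) = 0\<^sub>m ?n ?n"
      then have "- (- (x * x * ?F)) = - 0\<^sub>m ?n ?n"
        by (rule arg_cong)
      also have "- 0\<^sub>m ?n ?n = 0\<^sub>m ?n ?n * ?F"
        by auto
      finally have "x * x * ?F = 0\<^sub>m ?n ?n * ?F"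
        by simp
      then show "x * x = 0\<^sub>m ?n ?n"
        using x by (intro mult_symplectic_inj[of "x * x" l "0\<^sub>m ?n ?n"]) auto
    qed simp
    ultimately show ?thesis
      by simp
  qed
  ultimately show ?thesis
    using x by (auto simp: nilpotent2_def lie_sp_def sym_forms_def)
qed (simp add: nilpotent2_def lie_sp_def)

lemma orbit_iff:
  assumes "x \<in> carrier_mat (2 * l) (2 * l)"
  shows "y \<in> orbit (borel_SP l) (conjugation (2 * l)) x \<longleftrightarrow> y \<in> carrier_mat (2 * l) (2 * l) \<and>
    (\<exists>b\<in>borel l. y * symplectic_form l = b * (x * symplectic_form l) * b\<^sup>T)"
proof
  assume "y \<in> orbit (borel_SP l) (conjugation (2 * l)) x"
  then obtain b where b: "b \<in> borel l" "y = conjugation (2 * l) b x"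
    by (auto simp: orbit_def carrier_borel_SP)
  then have "y = b * x * inv_borel l b"
    by (simp add: conjugation_borel)
  then have "y \<in> carrier_mat (2 * l) (2 * l)"
    using borelD(1)[OF b(1)] by (intro carrier_matI) auto
  then show "y \<in> carrier_mat (2 * l) (2 * l) \<and>
    (\<exists>b\<in>borel l. y * symplectic_form l = b * (x * symplectic_form l) * b\<^sup>T)"
    using b conjugation_borel_form[OF b(1) assms] by blast
next
  assume "y \<in> carrier_mat (2 * l) (2 * l) \<and>
    (\<exists>b\<in>borel l. y * symplectic_form l = b * (x * symplectic_form l) * b\<^sup>T)"
  then obtain b where y: "y \<in> carrier_mat (2 * l) (2 * l)" and b: "b \<in> borel l"
    "y * symplectic_form l = b * (x * symplectic_form l) * b\<^sup>T"
    by blast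
  have "y = conjugation (2 * l) b x"
  proof (rule mult_symplectic_inj)
    show "y * symplectic_form l = conjugation (2 * l) b x * symplectic_form l"
      unfolding b(2) conjugation_borel_form[OF b(1) assms] ..
  qed (use y in \<open>simp_all add: conjugation_borel[OF b(1)]\<close>)
  then show "y \<in> orbit (borel_SP l) (conjugation (2 * l)) x"
    using b(1) by (auto simp: orbit_def carrier_borel_SP)
qed

lemma orbit_subset:
  assumes x: "x \<in> carrier_mat (2 * l) (2 * l)"
    and y: "y \<in> orbit (borel_SP l) (conjugation (2 * l)) x"
  shows "orbit (borel_SP l) (conjugation (2 * l)) y \<subseteq> orbit (borel_SP l) (conjugation (2 * l)) x"
proof
  fix z
  assume z: "z \<in> orbit (borel_SP l) (conjugation (2 * l)) y"
  have yc: "y \<in> carrier_mat (2 * l) (2 * l)"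
    using y orbit_iff[OF x] by blast
  obtain b where b: "b \<in> borel l" "y * symplectic_form l = b * (x * symplectic_form l) * b\<^sup>T"
    using y orbit_iff[OF x] by blast
  obtain c where c: "c \<in> borel l" "z * symplectic_form l = c * (y * symplectic_form l) * c\<^sup>T"
    and zc: "z \<in> carrier_mat (2 * l) (2 * l)"
    using z orbit_iff[OF yc] by blast
  have "z * symplectic_form l = (c * b) * (x * symplectic_form l) * (c * b)\<^sup>T"
    unfolding c(2) b(2)
    by (rule congruence_congruence[OF borelD(1)[OF b(1)] borelD(1)[OF c(1)]
        mult_carrier_mat[OF x symplectic_form_carrier]])
  then show "z \<in> orbit (borel_SP l) (conjugation (2 * l)) x"
    using orbit_iff[OF x] zc mult_borel[OF c(1) b(1)] by blast
qed

lemma orbit_eq: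
  assumes x: "x \<in> carrier_mat (2 * l) (2 * l)"
    and y: "y \<in> orbit (borel_SP l) (conjugation (2 * l)) x"
  shows "orbit (borel_SP l) (conjugation (2 * l)) y = orbit (borel_SP l) (conjugation (2 * l)) x"
proof
  have yc: "y \<in> carrier_mat (2 * l) (2 * l)"
    using y orbit_iff[OF x] by blast
  obtain b where b: "b \<in> borel l" "y * symplectic_form l = b * (x * symplectic_form l) * b\<^sup>T"
    using y orbit_iff[OF x] by blast
  have "x * symplectic_form l = inv_borel l b * (y * symplectic_form l) * (inv_borel l b)\<^sup>T"
    unfolding b(2)
    by (rule congruence_inv_borel[OF b(1) mult_carrier_mat[OF x symplectic_form_carrier], symmetric])
  then have "x \<in> orbit (borel_SP l) (conjugation (2 * l)) y"
    using orbit_iff[OF yc] x inv_borel[OF b(1)] by blast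
  then show "orbit (borel_SP l) (conjugation (2 * l)) x \<subseteq> orbit (borel_SP l) (conjugation (2 * l)) y"
    by (rule orbit_subset[OF yc])
qed (rule orbit_subset[OF assms])

text \<open>The preimage of \<open>pattern_form l T\<close> under \<open>x \<mapsto> x F\<close>;
  the sign comes from \<open>F F = -1\<close>.\<close>

definition pattern_matrix :: "nat \<Rightarrow> arrow set \<Rightarrow> complex mat" where
  "pattern_matrix l T = - (pattern_form l T * symplectic_form l)"

lemma pattern_matrix_carrier: "pattern_matrix l T \<in> carrier_mat (2 * l) (2 * l)"
  by (intro carrier_matI) (auto simp: pattern_matrix_def pattern_form_def)

lemma pattern_matrix_form: "pattern_matrix l T * symplectic_form l = pattern_form l T"
  using carrier_matD[OF pattern_form_carrier[of l T]]
  by (simp add: pattern_matrix_def mult_symplectic_cancel)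

theorem theorem6p3:
  fixes l :: nat
  assumes "l \<ge> 1"
  shows "\<exists>f. bij_betw f (orbits (borel_SP l) (nilpotent2 l) (conjugation (2 * l))) (Solp l)"
proof -
  let ?orb = "orbit (borel_SP l) (conjugation (2 * l))"
  \<comment> \<open>The map runs from patterns to orbits, where no choice of a representative is
    involved, and is inverted at the end. Injectivity is uniqueness of settled matrices,
    surjectivity is the reduction.\<close>
  let ?g = "\<lambda>T. ?orb (pattern_matrix l T)"
  have "inj_on ?g (Solp l)"
  proof (rule inj_onI)
    fix T T'
    assume T: "T \<in> Solp l" "T' \<in> Solp l" and eq: "?g T = ?g T'"
    have "pattern_matrix l T' \<in> ?g T'"
      unfolding orbit_iff[OF pattern_matrix_carrier]
      using one_borel[of l] pattern_matrix_carrier[of l T'] carrier_matD[OF pattern_form_carrier[of l T']]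
      by (intro conjI bexI[of _ "1\<^sub>m (2 * l)"]) (simp_all add: pattern_matrix_form)
    then have "pattern_matrix l T' \<in> ?g T"
      by (simp only: eq)
    then obtain b where b: "b \<in> borel l" "pattern_form l T' = b * pattern_form l T * b\<^sup>T"
      by (auto simp: orbit_iff[OF pattern_matrix_carrier] pattern_matrix_form)
    have "b * pattern_form l T * b\<^sup>T = pattern_form l T"
      using settled_pattern_form[OF T(2)] unfolding b(2)
      by (rule settled_congruent_unique[OF pattern_form_sym_forms[OF T(1)] settled_pattern_form[OF T(1)] b(1)])
    then show "T = T'"
      by (intro pattern_form_inj[OF T]) (simp only: b(2))
  qed
  moreover have "?g ` Solp l = orbits (borel_SP l) (nilpotent2 l) (conjugation (2 * l))"
  proof (intro Set.set_eqI iffI)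
    fix Q
    assume "Q \<in> ?g ` Solp l"
    then obtain T where "T \<in> Solp l" "Q = ?g T"
      by blast
    moreover from this have "pattern_matrix l T \<in> nilpotent2 l"
      by (simp add: nilpotent2_iff pattern_matrix_carrier pattern_matrix_form pattern_form_sym_forms)
    ultimately show "Q \<in> orbits (borel_SP l) (nilpotent2 l) (conjugation (2 * l))"
      by (auto simp: orbits_def)
  next
    fix Q
    assume "Q \<in> orbits (borel_SP l) (nilpotent2 l) (conjugation (2 * l))"
    then obtain x where x: "x \<in> nilpotent2 l" "Q = ?orb x"
      by (auto simp: orbits_def)
    then have xc: "x \<in> carrier_mat (2 * l) (2 * l)" and S: "x * symplectic_form l \<in> sym_forms l"
      by (simp_all add: nilpotent2_iff)
    obtain b where b: "b \<in> borel l" "settled l (b * (x * symplectic_form l) * b\<^sup>T) {..<2 * l}"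
      using settle[OF S] by blast
    obtain T where T: "T \<in> Solp l" "pattern_form l T = b * (x * symplectic_form l) * b\<^sup>T"
      using pattern_form_surj[OF congruence_sym_forms[OF b(1) S] b(2)] by blast
    have "pattern_matrix l T \<in> ?orb x"
      unfolding orbit_iff[OF xc] pattern_matrix_form using T(2) b(1) pattern_matrix_carrier by blast
    then show "Q \<in> ?g ` Solp l"
      using orbit_eq[OF xc] T(1) x(2) by blast
  qed
  ultimately have "bij_betw ?g (Solp l) (orbits (borel_SP l) (nilpotent2 l) (conjugation (2 * l)))"
    by (simp add: bij_betw_def)
  then show ?thesis
    using bij_betw_inv by blast
qed

end
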